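(* Let $G$ and $H$ be countable groups. Then the free product $G*H$ belongs to the class $\mathcal{A}$ if and only if neither of the following two conditions holds: (a) $G$ has property (F) and $H$ has virtually (F); (b) $H$ has property (F) and $G$ has virtually (F).
   Context: "Countable" always means of cardinality $\aleph_0$ (in particular infinite). An action of a group $G$ on a set $X$ is called amenable if there is an invariant mean on $X$, i.e. a $G$-invariant map $\mu$ from the collection of all subsets of $X$ to $[0,1]$ such that $\mu(A\cup B)=\mu(A)+\mu(B)$ whenever $A\cap B=\varnothing$, and $\mu(X)=1$. The class $\mathcal{A}$ is the class of all countable groups $G$ that admit a faithful transitive amenable action on some set. A countable group $G$ has the fixed point property (F) if every amenable $G$-action on a countable set has a fixed point (a point fixed by all of $G$). A countable group has virtually (F) if it has a finite index subgroup (possibly the group itself) with property (F). *)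

theory Defs
  imports Complex_Main "HOL-Algebra.Group_Action" "HOL-Library.Countable_Set"
begin

section \<open>Amenable actions, the class A and the fixed point property\<close>

definition countable_group :: "('a, 'm) monoid_scheme \<Rightarrow> bool" where
  "countable_group G \<longleftrightarrow> group G \<and> countable (carrier G) \<and> infinite (carrier G)"

text \<open>A mean on \<open>S\<close> is only constrained on subsets of \<open>S\<close>.\<close>

definition invariant_mean ::
  "('a, 'm) monoid_scheme \<Rightarrow> 'x set \<Rightarrow> ('a \<Rightarrow> 'x \<Rightarrow> 'x) \<Rightarrow> ('x set \<Rightarrow> real) \<Rightarrow> bool" where
  "invariant_mean G S \<phi> m \<longleftrightarrow>
     (\<forall>A. A \<subseteq> S \<longrightarrow> 0 \<le> m A \<and> m A \<le> 1) \<and>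
     (\<forall>A B. A \<subseteq> S \<longrightarrow> B \<subseteq> S \<longrightarrow> A \<inter> B = {} \<longrightarrow> m (A \<union> B) = m A + m B) \<and>
     m S = 1 \<and>
     (\<forall>g\<in>carrier G. \<forall>A. A \<subseteq> S \<longrightarrow> m (\<phi> g ` A) = m A)"

definition amenable_action ::
  "('a, 'm) monoid_scheme \<Rightarrow> 'x set \<Rightarrow> ('a \<Rightarrow> 'x \<Rightarrow> 'x) \<Rightarrow> bool" where
  "amenable_action G S \<phi> \<longleftrightarrow> group_action G S \<phi> \<and> (\<exists>m. invariant_mean G S \<phi> m)"

text \<open>
  HOL formulas cannot quantify over the type of the points of \<open>S\<close>, so in the next two definitions
  \<open>S\<close> ranges over sets of natural numbers. Nothing is lost: a set with a transitive action of a
  countable group is countable, and actions can be transported along a bijection of \<open>S\<close> with a set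
  of natural numbers. The lemmas \<open>in_class_A_I\<close> and \<open>property_F_D\<close> below give both definitions for
  points of arbitrary type.
\<close>

definition in_class_A :: "('a, 'm) monoid_scheme \<Rightarrow> bool" where
  "in_class_A G \<longleftrightarrow> countable_group G \<and>
     (\<exists>(S :: nat set) \<phi>. faithful_action G S \<phi> \<and> transitive_action G S \<phi> \<and> amenable_action G S \<phi>)"

definition property_F :: "('a, 'm) monoid_scheme \<Rightarrow> bool" where
  "property_F G \<longleftrightarrow>
     (\<forall>(S :: nat set) \<phi>. infinite S \<longrightarrow> amenable_action G S \<phi> \<longrightarrow>
        (\<exists>x\<in>S. \<forall>g\<in>carrier G. \<phi> g x = x))"

definition virtually_F :: "('a, 'm) monoid_scheme \<Rightarrow> bool" where
  "virtually_F G \<longleftrightarrow>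
     (\<exists>K. subgroup K G \<and> finite (rcosets\<^bsub>G\<^esub> K) \<and> property_F (G\<lparr>carrier := K\<rparr>))"

subsection \<open>Independence of the type of points\<close>

definition transport_action :: "'x set \<Rightarrow> ('x \<Rightarrow> 'y) \<Rightarrow> ('a \<Rightarrow> 'x \<Rightarrow> 'x) \<Rightarrow> 'a \<Rightarrow> 'y \<Rightarrow> 'y" where
  "transport_action S f \<phi> g = (\<lambda>y\<in>f ` S. f (\<phi> g (inv_into S f y)))"

lemma transport_action_apply:
  assumes "inj_on f S" "x \<in> S"
  shows "transport_action S f \<phi> g (f x) = f (\<phi> g x)"
  using assms by (simp add: transport_action_def)

lemma group_action_closed:
  assumes "group_action G S \<phi>" "g \<in> carrier G" "x \<in> S"
  shows "\<phi> g x \<in> S"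
  using group_action.surj_prop[OF assms(1,2)] assms(3) by blast

lemma transport_action_Bij:
  assumes "group_action G S \<phi>" "inj_on f S" "g \<in> carrier G"
  shows "transport_action S f \<phi> g \<in> Bij (f ` S)"
proof -
  have "transport_action S f \<phi> g ` f ` S = f ` \<phi> g ` S"
    by (simp add: image_image transport_action_apply[OF assms(2)] cong: image_cong_simp)
  then have 1: "transport_action S f \<phi> g ` f ` S = f ` S"
    using group_action.surj_prop[OF assms(1,3)] by simp
  have "inj_on (transport_action S f \<phi> g) (f ` S)"
  proof (rule inj_onI, clarify)
    fix x y
    assume xy: "x \<in> S" "y \<in> S"
      and "transport_action S f \<phi> g (f x) = transport_action S f \<phi> g (f y)"
    then have "f (\<phi> g x) = f (\<phi> g y)"
      by (simp add: transport_action_apply[OF assms(2)])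
    then have "\<phi> g x = \<phi> g y"
      using assms xy by (meson group_action_closed inj_onD)
    then show "f x = f y"
      using group_action.inj_prop[OF assms(1,3)] xy by (metis inj_onD)
  qed
  with 1 show ?thesis
    by (simp add: Bij_def bij_betw_def transport_action_def)
qed

lemma group_action_transport:
  assumes act: "group_action G S \<phi>" and inj: "inj_on f S"
  shows "group_action G (f ` S) (transport_action S f \<phi>)"
proof -
  interpret group_action G S \<phi> by fact
  have G: "group G"
    using group_hom group_hom.axioms(1) by blast
  have "transport_action S f \<phi> \<in> hom G (BijGroup (f ` S))"
  proof (rule homI)
    fix g assume "g \<in> carrier G"
    then show "transport_action S f \<phi> g \<in> carrier (BijGroup (f ` S))"
      using transport_action_Bij[OF act inj] by (simp add: BijGroup_def)
  next
    fix g h assume gh: "g \<in> carrier G" "h \<in> carrier G"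
    have "transport_action S f \<phi> (g \<otimes>\<^bsub>G\<^esub> h) y =
        compose (f ` S) (transport_action S f \<phi> g) (transport_action S f \<phi> h) y" for y
    proof (cases "y \<in> f ` S")
      case True
      then obtain x where x: "x \<in> S" "y = f x" by blast
      with gh have "\<phi> h x \<in> S" by (meson act group_action_closed)
      then show ?thesis
        using x gh composition_rule[OF x(1) gh]
        by (simp add: compose_def transport_action_apply[OF inj])
    next
      case False
      then show ?thesis by (simp add: compose_def transport_action_def)
    qed
    then show "transport_action S f \<phi> (g \<otimes>\<^bsub>G\<^esub> h) =
        transport_action S f \<phi> g \<otimes>\<^bsub>BijGroup (f ` S)\<^esub> transport_action S f \<phi> h"
      using transport_action_Bij[OF act inj] gh by (simp add: BijGroup_def fun_eq_iff)
  qed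
  then show ?thesis
    using G group_BijGroup
    by (simp add: group_action_def group_hom_def group_hom_axioms_def)
qed

lemma faithful_action_transport:
  assumes "faithful_action G S \<phi>" and inj: "inj_on f S"
  shows "faithful_action G (f ` S) (transport_action S f \<phi>)"
proof -
  interpret faithful_action G S \<phi> by fact
  have act: "group_action G S \<phi>" by unfold_locales
  have "inj_on (transport_action S f \<phi>) (carrier G)"
  proof (rule inj_onI)
    fix g h
    assume gh: "g \<in> carrier G" "h \<in> carrier G"
      and eq: "transport_action S f \<phi> g = transport_action S f \<phi> h"
    have "\<phi> g x = \<phi> h x" if "x \<in> S" for x
    proof -
      have "f (\<phi> g x) = f (\<phi> h x)"
        using transport_action_apply[OF inj that] eq by metis
      then show ?thesis
        using gh that act inj by (meson group_action_closed inj_onD)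
    qed
    moreover have "\<phi> g \<in> extensional S" "\<phi> h \<in> extensional S"
      using gh bij_prop0 by (auto dest: Bij_imp_extensional)
    ultimately have "\<phi> g = \<phi> h" by (metis extensionalityI)
    then show "g = h" using faithful gh by (simp add: inj_on_def)
  qed
  then show ?thesis
    using group_action_transport[OF act inj]
    by (simp add: faithful_action_def faithful_action_axioms_def)
qed

lemma transitive_action_transport:
  assumes "transitive_action G S \<phi>" and inj: "inj_on f S"
  shows "transitive_action G (f ` S) (transport_action S f \<phi>)"
proof -
  interpret transitive_action G S \<phi> by fact
  have act: "group_action G S \<phi>" by unfold_locales
  have "\<exists>g\<in>carrier G. transport_action S f \<phi> g y = z" if yz: "y \<in> f ` S" "z \<in> f ` S" for y z
    using unique_orbit transport_action_apply[OF inj] yz by (smt (verit) imageE)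
  then show ?thesis
    using group_action_transport[OF act inj]
    by (simp add: transitive_action_def transitive_action_axioms_def)
qed

lemma amenable_action_transport:
  assumes am: "amenable_action G S \<phi>" and inj: "inj_on f S"
  shows "amenable_action G (f ` S) (transport_action S f \<phi>)"
proof -
  from am obtain m where act: "group_action G S \<phi>" and m: "invariant_mean G S \<phi> m"
    by (auto simp: amenable_action_def)
  define n where "n B = m (S \<inter> f -` B)" for B
  have "n (B \<union> C) = n B + n C" if "B \<inter> C = {}" for B C
  proof -
    have "(S \<inter> f -` B) \<inter> (S \<inter> f -` C) = {}" "S \<inter> f -` (B \<union> C) = (S \<inter> f -` B) \<union> (S \<inter> f -` C)"
      using that by auto
    then show ?thesis using m by (simp add: n_def invariant_mean_def)
  qed
  moreover have "S \<inter> f -` f ` S = S" by auto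
  then have "n (f ` S) = 1"
    using m by (simp add: n_def invariant_mean_def)
  moreover have "n (transport_action S f \<phi> g ` B) = n B"
    if g: "g \<in> carrier G" and B: "B \<subseteq> f ` S" for g B
  proof -
    obtain A where A: "A \<subseteq> S" "B = f ` A" using B by (meson subset_imageE)
    have inv: "S \<inter> f -` f ` C = C" if "C \<subseteq> S" for C
      using that inj by (auto dest: inj_onD)
    have "transport_action S f \<phi> g ` B = f ` \<phi> g ` A"
      using A by (force simp: image_image transport_action_apply[OF inj] subset_iff intro!: image_cong)
    moreover have "\<phi> g ` A \<subseteq> S"
      using A g act by (auto intro: group_action_closed)
    ultimately show ?thesis
      using m A g by (simp add: n_def inv invariant_mean_def)
  qed
  ultimately have "invariant_mean G (f ` S) (transport_action S f \<phi>) n"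
    using m by (simp add: invariant_mean_def n_def)
  then show ?thesis
    using group_action_transport[OF act inj] by (auto simp: amenable_action_def)
qed

lemma in_class_A_I:
  fixes S :: "'x set"
  assumes G: "countable_group G"
    and "faithful_action G S \<phi>" "transitive_action G S \<phi>" "amenable_action G S \<phi>"
  shows "in_class_A G"
proof -
  have "countable S"
  proof (cases "S = {}")
    case False
    then obtain x where "x \<in> S" by blast
    then have "S \<subseteq> (\<lambda>g. \<phi> g x) ` carrier G"
      using transitive_action.unique_orbit[OF assms(3)] by blast
    then show ?thesis
      using G countable_group_def countable_image countable_subset by metis
  qed simp
  then obtain f :: "'x \<Rightarrow> nat" where "inj_on f S" by (auto simp: countable_def)
  then show ?thesis
    unfolding in_class_A_def
    using G faithful_action_transport[OF assms(2)] transitive_action_transport[OF assms(3)]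
      amenable_action_transport[OF assms(4)] by blast
qed

lemma property_F_D:
  fixes S :: "'x set"
  assumes F: "property_F G" and S: "countable S" "infinite S" and am: "amenable_action G S \<phi>"
  shows "\<exists>x\<in>S. \<forall>g\<in>carrier G. \<phi> g x = x"
proof -
  obtain f :: "'x \<Rightarrow> nat" where inj: "inj_on f S" using S by (auto simp: countable_def)
  have "infinite (f ` S)" using S inj finite_imageD by blast
  then obtain x where x: "x \<in> S"
    and fix_x: "\<forall>g\<in>carrier G. transport_action S f \<phi> g (f x) = f x"
    using F amenable_action_transport[OF am inj] unfolding property_F_def by blast
  have "group_action G S \<phi>" using am by (simp add: amenable_action_def)
  then have "\<phi> g x = x" if "g \<in> carrier G" for g
    using that fix_x x transport_action_apply[OF inj x] inj group_action_closed inj_onD by metis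
  with x show ?thesis by blast
qed

section \<open>Free products of groups\<close>

text \<open>
  The elements are the reduced words: nontrivial letters, taken alternately from the two
  factors. Words are multiplied by prepending the letters of the first one to the second one, from
  the last letter to the first.
\<close>

fun fp_letter :: "('a, 'm) monoid_scheme \<Rightarrow> ('b, 'n) monoid_scheme \<Rightarrow> 'a + 'b \<Rightarrow> bool" where
  "fp_letter G H (Inl g) \<longleftrightarrow> g \<in> carrier G \<and> g \<noteq> \<one>\<^bsub>G\<^esub>"
| "fp_letter G H (Inr h) \<longleftrightarrow> h \<in> carrier H \<and> h \<noteq> \<one>\<^bsub>H\<^esub>"

definition fp_words :: "('a, 'm) monoid_scheme \<Rightarrow> ('b, 'n) monoid_scheme \<Rightarrow> ('a + 'b) list set" where
  "fp_words G H = {w. (\<forall>x\<in>set w. fp_letter G H x) \<and> distinct_adj (map isl w)}"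

fun fp_cons ::
  "('a, 'm) monoid_scheme \<Rightarrow> ('b, 'n) monoid_scheme \<Rightarrow> 'a + 'b \<Rightarrow> ('a + 'b) list \<Rightarrow> ('a + 'b) list" where
  "fp_cons G H (Inl g) (Inl g' # w) =
     (if g \<otimes>\<^bsub>G\<^esub> g' = \<one>\<^bsub>G\<^esub> then w else Inl (g \<otimes>\<^bsub>G\<^esub> g') # w)"
| "fp_cons G H (Inr h) (Inr h' # w) =
     (if h \<otimes>\<^bsub>H\<^esub> h' = \<one>\<^bsub>H\<^esub> then w else Inr (h \<otimes>\<^bsub>H\<^esub> h') # w)"
| "fp_cons G H x w = x # w"

definition free_product ::
  "('a, 'm) monoid_scheme \<Rightarrow> ('b, 'n) monoid_scheme \<Rightarrow> ('a + 'b) list monoid" where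
  "free_product G H =
     \<lparr>carrier = fp_words G H, mult = (\<lambda>u v. foldr (fp_cons G H) u v), one = []\<rparr>"

definition fp_inl :: "('a, 'm) monoid_scheme \<Rightarrow> 'a \<Rightarrow> ('a + 'b) list" where
  "fp_inl G g = (if g = \<one>\<^bsub>G\<^esub> then [] else [Inl g])"

definition fp_inr :: "('b, 'n) monoid_scheme \<Rightarrow> 'b \<Rightarrow> ('a + 'b) list" where
  "fp_inr H h = (if h = \<one>\<^bsub>H\<^esub> then [] else [Inr h])"

context
  fixes G :: "('a, 'm) monoid_scheme" and H :: "('b, 'n) monoid_scheme"
  assumes G: "group G" and H: "group H"
begin

interpretation G: group G by (rule G)
interpretation H: group H by (rule H)

lemma fp_cons_closed:
  assumes "fp_letter G H x" "w \<in> fp_words G H"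
  shows "fp_cons G H x w \<in> fp_words G H"
  using assms
  by (cases "(G, H, x, w)" rule: fp_cons.cases)
     (auto simp: fp_words_def distinct_adj_Cons split: sum.splits)

lemma fp_mult_closed:
  assumes "\<forall>x\<in>set u. fp_letter G H x" "v \<in> fp_words G H"
  shows "foldr (fp_cons G H) u v \<in> fp_words G H"
  using assms by (induction u) (auto intro: fp_cons_closed)

lemma fp_cons_Inl_Inl:
  assumes "fp_letter G H (Inl g)" "fp_letter G H (Inl g')" "w \<in> fp_words G H"
  shows "fp_cons G H (Inl g) (fp_cons G H (Inl g') w) =
    (if g \<otimes>\<^bsub>G\<^esub> g' = \<one>\<^bsub>G\<^esub> then w else fp_cons G H (Inl (g \<otimes>\<^bsub>G\<^esub> g')) w)"
proof -
  consider (other) "\<And>y. fp_cons G H (Inl y) w = Inl y # w"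
    | (same) k w' where "w = Inl k # w'" "k \<in> carrier G" "k \<noteq> \<one>\<^bsub>G\<^esub>"
        "\<And>y. fp_cons G H (Inl y) w' = Inl y # w'"
  proof (cases w)
    case (Cons x w')
    then show ?thesis
      using assms(3) that
      by (cases x; cases w'; cases "hd w'") (auto simp: fp_words_def distinct_adj_Cons)
  qed (use that in auto)
  then show ?thesis
  proof cases
    case other
    then show ?thesis by simp
  next
    case (same k w')
    have "g \<otimes>\<^bsub>G\<^esub> (g' \<otimes>\<^bsub>G\<^esub> k) = (g \<otimes>\<^bsub>G\<^esub> g') \<otimes>\<^bsub>G\<^esub> k"
      using assms same by (simp add: G.m_assoc)
    moreover have "(g \<otimes>\<^bsub>G\<^esub> g') \<otimes>\<^bsub>G\<^esub> k = g" if "g' \<otimes>\<^bsub>G\<^esub> k = \<one>\<^bsub>G\<^esub>"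
      using assms same that by (simp add: G.m_assoc)
    ultimately show ?thesis
      using assms same by auto
  qed
qed

lemma fp_cons_Inr_Inr:
  assumes "fp_letter G H (Inr g)" "fp_letter G H (Inr g')" "w \<in> fp_words G H"
  shows "fp_cons G H (Inr g) (fp_cons G H (Inr g') w) =
    (if g \<otimes>\<^bsub>H\<^esub> g' = \<one>\<^bsub>H\<^esub> then w else fp_cons G H (Inr (g \<otimes>\<^bsub>H\<^esub> g')) w)"
proof -
  consider (other) "\<And>y. fp_cons G H (Inr y) w = Inr y # w"
    | (same) k w' where "w = Inr k # w'" "k \<in> carrier H" "k \<noteq> \<one>\<^bsub>H\<^esub>"
        "\<And>y. fp_cons G H (Inr y) w' = Inr y # w'"
  proof (cases w)
    case (Cons x w')
    then show ?thesis
      using assms(3) that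
      by (cases x; cases w'; cases "hd w'") (auto simp: fp_words_def distinct_adj_Cons)
  qed (use that in auto)
  then show ?thesis
  proof cases
    case other
    then show ?thesis by simp
  next
    case (same k w')
    have "g \<otimes>\<^bsub>H\<^esub> (g' \<otimes>\<^bsub>H\<^esub> k) = (g \<otimes>\<^bsub>H\<^esub> g') \<otimes>\<^bsub>H\<^esub> k"
      using assms same by (simp add: H.m_assoc)
    moreover have "(g \<otimes>\<^bsub>H\<^esub> g') \<otimes>\<^bsub>H\<^esub> k = g" if "g' \<otimes>\<^bsub>H\<^esub> k = \<one>\<^bsub>H\<^esub>"
      using assms same that by (simp add: H.m_assoc)
    ultimately show ?thesis
      using assms same by auto
  qed
qed

lemma fp_cons_mult:
  assumes x: "fp_letter G H x" and v: "v \<in> fp_words G H" and w: "w \<in> fp_words G H"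
  shows "foldr (fp_cons G H) (fp_cons G H x v) w = fp_cons G H x (foldr (fp_cons G H) v w)"
proof (cases "(G, H, x, v)" rule: fp_cons.cases)
  case (1 G' H' g g' v')
  then have "foldr (fp_cons G H) v' w \<in> fp_words G H"
    using v w by (intro fp_mult_closed) (auto simp: fp_words_def)
  with 1 x v show ?thesis
    using fp_cons_Inl_Inl[of g g'] by (auto simp: fp_words_def)
next
  case (2 G' H' g g' v')
  then have "foldr (fp_cons G H) v' w \<in> fp_words G H"
    using v w by (intro fp_mult_closed) (auto simp: fp_words_def)
  with 2 x v show ?thesis
    using fp_cons_Inr_Inr[of g g'] by (auto simp: fp_words_def)
qed auto

lemma fp_mult_assoc:
  assumes "\<forall>x\<in>set u. fp_letter G H x" "v \<in> fp_words G H" "w \<in> fp_words G H"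
  shows "foldr (fp_cons G H) (foldr (fp_cons G H) u v) w =
    foldr (fp_cons G H) u (foldr (fp_cons G H) v w)"
  using assms by (induction u) (auto simp: fp_cons_mult fp_mult_closed)

lemma fp_mult_Nil: "w \<in> fp_words G H \<Longrightarrow> foldr (fp_cons G H) w [] = w"
proof (induction w)
  case (Cons x w)
  then show ?case
    by (cases x; cases w; cases "hd w") (auto simp: fp_words_def distinct_adj_Cons)
qed simp

lemma fp_letter_inverse:
  assumes "fp_letter G H x"
  obtains y where "fp_letter G H y" "\<And>w. fp_cons G H y (x # w) = w"
proof (cases x)
  case (Inl g)
  then show ?thesis using assms that[of "Inl (inv\<^bsub>G\<^esub> g)"] by simp
next
  case (Inr h)
  then show ?thesis using assms that[of "Inr (inv\<^bsub>H\<^esub> h)"] by simp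
qed

lemma fp_left_inverse:
  assumes "w \<in> fp_words G H"
  shows "\<exists>u\<in>fp_words G H. foldr (fp_cons G H) u w = []"
  using assms
proof (induction w)
  case Nil
  then show ?case by force
next
  case (Cons x w)
  then have w: "w \<in> fp_words G H" and x: "fp_letter G H x"
    by (auto simp: fp_words_def distinct_adj_Cons)
  obtain y where y: "fp_letter G H y" "\<And>w. fp_cons G H y (x # w) = w"
    using fp_letter_inverse[OF x] by blast
  from Cons w obtain u where u: "u \<in> fp_words G H" "foldr (fp_cons G H) u w = []" by blast
  have yw: "[y] \<in> fp_words G H" using y by (simp add: fp_words_def)
  have "foldr (fp_cons G H) u [y] \<in> fp_words G H"
    using u yw by (intro fp_mult_closed) (auto simp: fp_words_def)
  moreover have "foldr (fp_cons G H) (foldr (fp_cons G H) u [y]) (x # w) = []"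
    using u yw Cons.prems y by (subst fp_mult_assoc) (auto simp: fp_words_def)
  ultimately show ?case by blast
qed

theorem group_free_product: "group (free_product G H)"
proof (rule groupI)
  fix u v w
  assume "u \<in> carrier (free_product G H)" "v \<in> carrier (free_product G H)"
    "w \<in> carrier (free_product G H)"
  then show "u \<otimes>\<^bsub>free_product G H\<^esub> v \<otimes>\<^bsub>free_product G H\<^esub> w =
      u \<otimes>\<^bsub>free_product G H\<^esub> (v \<otimes>\<^bsub>free_product G H\<^esub> w)"
    unfolding free_product_def by (simp, intro fp_mult_assoc) (auto simp: fp_words_def)
next
  fix u v
  assume "u \<in> carrier (free_product G H)" "v \<in> carrier (free_product G H)"
  then show "u \<otimes>\<^bsub>free_product G H\<^esub> v \<in> carrier (free_product G H)"
    unfolding free_product_def by (simp, intro fp_mult_closed) (auto simp: fp_words_def)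
next
  fix u
  assume "u \<in> carrier (free_product G H)"
  then show "\<exists>v\<in>carrier (free_product G H). v \<otimes>\<^bsub>free_product G H\<^esub> u = \<one>\<^bsub>free_product G H\<^esub>"
    using fp_left_inverse by (simp add: free_product_def)
qed (auto simp: free_product_def fp_words_def)

lemma fp_inl_hom: "fp_inl G \<in> hom G (free_product G H)"
  by (rule homI) (auto simp: fp_inl_def free_product_def fp_words_def)

lemma fp_inr_hom: "fp_inr H \<in> hom H (free_product G H)"
  by (rule homI) (auto simp: fp_inr_def free_product_def fp_words_def)

theorem free_product_universal:
  fixes K :: "('c, 'k) monoid_scheme"
  assumes K: "group K" and f: "f \<in> hom G K" and k: "k \<in> hom H K"
  shows "\<exists>e\<in>hom (free_product G H) K.
      (\<forall>g\<in>carrier G. e (fp_inl G g) = f g) \<and> (\<forall>h\<in>carrier H. e (fp_inr H h) = k h)"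
proof -
  interpret K: group K by (rule K)
  define l where "l = case_sum f k"
  define e where "e w = foldr (\<lambda>x z. l x \<otimes>\<^bsub>K\<^esub> z) w \<one>\<^bsub>K\<^esub>" for w
  have f1: "f \<one>\<^bsub>G\<^esub> = \<one>\<^bsub>K\<^esub>" and k1: "k \<one>\<^bsub>H\<^esub> = \<one>\<^bsub>K\<^esub>"
    using f k G H K by (simp_all add: hom_one)
  have l_closed: "l x \<in> carrier K" if "fp_letter G H x" for x
    using that f k by (cases x) (auto simp: l_def hom_in_carrier)
  have e_closed: "e w \<in> carrier K" if "\<forall>x\<in>set w. fp_letter G H x" for w
    using that by (induction w) (auto simp: e_def l_closed)
  have e_cons: "e (fp_cons G H x w) = l x \<otimes>\<^bsub>K\<^esub> e w"
    if x: "fp_letter G H x" and w: "w \<in> fp_words G H" for x w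
  proof (cases "(G, H, x, w)" rule: fp_cons.cases)
    case (1 G' H' g g' w')
    then have "e w' \<in> carrier K" "g \<in> carrier G" "g' \<in> carrier G"
      using x w by (auto intro: e_closed simp: fp_words_def)
    moreover have "f g \<otimes>\<^bsub>K\<^esub> (f g' \<otimes>\<^bsub>K\<^esub> e w') = f (g \<otimes>\<^bsub>G\<^esub> g') \<otimes>\<^bsub>K\<^esub> e w'"
      using calculation f by (simp add: hom_mult hom_in_carrier K.m_assoc)
    ultimately show ?thesis
      using 1 f1 by (auto simp: e_def l_def)
  next
    case (2 G' H' g g' w')
    then have "e w' \<in> carrier K" "g \<in> carrier H" "g' \<in> carrier H"
      using x w by (auto intro: e_closed simp: fp_words_def)
    moreover have "k g \<otimes>\<^bsub>K\<^esub> (k g' \<otimes>\<^bsub>K\<^esub> e w') = k (g \<otimes>\<^bsub>H\<^esub> g') \<otimes>\<^bsub>K\<^esub> e w'"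
      using calculation k by (simp add: hom_mult hom_in_carrier K.m_assoc)
    ultimately show ?thesis
      using 2 k1 by (auto simp: e_def l_def)
  qed (auto simp: e_def)
  have e_mult: "e (foldr (fp_cons G H) u v) = e u \<otimes>\<^bsub>K\<^esub> e v"
    if "\<forall>x\<in>set u. fp_letter G H x" and v: "v \<in> fp_words G H" for u v
    using that(1)
  proof (induction u)
    case Nil
    then show ?case using v e_closed by (simp add: e_def fp_words_def)
  next
    case (Cons x u)
    have "e (x # u) = l x \<otimes>\<^bsub>K\<^esub> e u" by (simp add: e_def)
    moreover have "e v \<in> carrier K" using v e_closed by (simp add: fp_words_def)
    ultimately show ?case
      using Cons v by (simp add: e_cons fp_mult_closed e_closed l_closed K.m_assoc)
  qed
  have "e \<in> hom (free_product G H) K"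
    by (rule homI) (auto simp: free_product_def fp_words_def e_closed intro!: e_mult)
  moreover have "e (fp_inl G g) = f g" if "g \<in> carrier G" for g
    using that f f1 by (simp add: e_def fp_inl_def l_def hom_in_carrier)
  moreover have "e (fp_inr H h) = k h" if "h \<in> carrier H" for h
    using that k k1 by (simp add: e_def fp_inr_def l_def hom_in_carrier)
  ultimately show "\<exists>e\<in>hom (free_product G H) K.
      (\<forall>g\<in>carrier G. e (fp_inl G g) = f g) \<and> (\<forall>h\<in>carrier H. e (fp_inr H h) = k h)"
    by blast
qed

theorem free_product_universal_unique:
  fixes K :: "('c, 'k) monoid_scheme"
  assumes "group K" and d: "d \<in> hom (free_product G H) K" and e: "e \<in> hom (free_product G H) K"
    and dl: "\<And>g. g \<in> carrier G \<Longrightarrow> d (fp_inl G g) = e (fp_inl G g)"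
    and dr: "\<And>h. h \<in> carrier H \<Longrightarrow> d (fp_inr H h) = e (fp_inr H h)"
    and "w \<in> carrier (free_product G H)"
  shows "d w = e w"
  using assms(6)
proof (induction w)
  case Nil
  have "[] = \<one>\<^bsub>free_product G H\<^esub>" by (simp add: free_product_def)
  then show ?case
    using hom_one[OF d group_free_product \<open>group K\<close>] hom_one[OF e group_free_product \<open>group K\<close>]
    by simp
next
  case (Cons x w)
  then have w: "w \<in> carrier (free_product G H)" and x: "[x] \<in> carrier (free_product G H)"
    by (auto simp: free_product_def fp_words_def distinct_adj_Cons)
  have "x # w = fp_cons G H x w"
    using Cons.prems
    by (cases x; cases w; cases "hd w") (auto simp: free_product_def fp_words_def distinct_adj_Cons)
  then have eq: "x # w = [x] \<otimes>\<^bsub>free_product G H\<^esub> w"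
    by (simp add: free_product_def)
  have "d [x] = e [x]"
  proof (cases x)
    case (Inl g)
    then show ?thesis
      using x dl[of g] by (auto simp: fp_inl_def free_product_def fp_words_def)
  next
    case (Inr h)
    then show ?thesis
      using x dr[of h] by (auto simp: fp_inr_def free_product_def fp_words_def)
  qed
  then show ?case
    unfolding eq hom_mult[OF d x w] hom_mult[OF e x w] using Cons.IH[OF w] by simp
qed

end

end

theory Submission
  imports Defs "HOL-Analysis.Function_Topology"
begin

text \<open>
  Suppose first that \<open>G\<close> has property (F) and that \<open>H\<close> has a subgroup of finite index with
  property (F). A mean that is invariant under a group with (F) gives mean 1 to the fixed points
  (\<open>property_F_mean_fixed\<close>). Hence in an amenable action of the free product there is a point whose
  \<open>H\<close>-orbit consists of fixed points of \<open>G\<close>, and a transitive action is not faithful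
  (\<open>property_F_virtually_F_not_class_A\<close>).

  For the converse, a faithful and transitive amenable action is assembled from two parts: a set
  \<open>X\<close> with actions of \<open>G\<close> and \<open>H\<close> that have a common invariant mean, and the free product acting on
  its own words, which is given mean zero and provides faithfulness. The parts are joined along a set
  \<open>T\<close> of points of \<open>X\<close> that \<open>H\<close> fixes. This leaves the mean invariant if \<open>T\<close> is null, and makes the action transitive
  if \<open>T\<close> meets every jointly stable set (\<open>null_attachment\<close>). It remains to find \<open>X\<close> and \<open>T\<close>.

  If \<open>G\<close> does not virtually have (F), then it has amenable actions all of whose orbits are large
  (\<open>not_virtually_F_imp_orbits_ge\<close>). If the orbits have at least \<open>n\<close> points, then a set with one
  point in each of them can be chosen with mean at most \<open>1/n\<close>, and in a limit of
  such actions one obtains a null set that meets every orbit (\<open>has_null_sweepI\<close>); here \<open>H\<close> may act trivially. The case that \<open>H\<close> does not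
  virtually have (F) is symmetric. If both groups virtually have (F), then the hypothesis says that
  neither of them has (F). In that case either one obtains a null set in the same way, or
  both groups have finite transitive actions on at least two points (\<open>not_F_cases\<close>), and these
  can be strung together to a line on which the density is an invariant mean, with one end of
  the line as \<open>T\<close> (\<open>transitive_of_degree_imp_class_A\<close>). For two groups of order 2 this line would be the
  action of the infinite dihedral group on a half-line.
\<close>

section \<open>Actions and means\<close>

text \<open>
  Values outside \<open>S\<close> are left arbitrary, so that explicit formulas can serve as actions. Restricting
  the maps to \<open>S\<close> gives the extensional maps of \<open>group_action\<close>, see \<open>acts_on_imp_group_action\<close>.
\<close>

definition acts_on :: "('a, 'm) monoid_scheme \<Rightarrow> 'x set \<Rightarrow> ('a \<Rightarrow> 'x \<Rightarrow> 'x) \<Rightarrow> bool" where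
  "acts_on G S \<phi> \<longleftrightarrow>
     (\<forall>g\<in>carrier G. \<forall>x\<in>S. \<phi> g x \<in> S) \<and> (\<forall>x\<in>S. \<phi> \<one>\<^bsub>G\<^esub> x = x) \<and>
     (\<forall>g\<in>carrier G. \<forall>h\<in>carrier G. \<forall>x\<in>S. \<phi> (g \<otimes>\<^bsub>G\<^esub> h) x = \<phi> g (\<phi> h x))"

lemma acts_onI:
  assumes "\<And>g x. g \<in> carrier G \<Longrightarrow> x \<in> S \<Longrightarrow> \<phi> g x \<in> S"
    and "\<And>x. x \<in> S \<Longrightarrow> \<phi> \<one>\<^bsub>G\<^esub> x = x"
    and "\<And>g h x. g \<in> carrier G \<Longrightarrow> h \<in> carrier G \<Longrightarrow> x \<in> S \<Longrightarrow> \<phi> (g \<otimes>\<^bsub>G\<^esub> h) x = \<phi> g (\<phi> h x)"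
  shows "acts_on G S \<phi>"
  using assms by (simp add: acts_on_def)

lemma acts_on_closed: "acts_on G S \<phi> \<Longrightarrow> g \<in> carrier G \<Longrightarrow> x \<in> S \<Longrightarrow> \<phi> g x \<in> S"
  by (simp add: acts_on_def)

lemma acts_on_one: "acts_on G S \<phi> \<Longrightarrow> x \<in> S \<Longrightarrow> \<phi> \<one>\<^bsub>G\<^esub> x = x"
  by (simp add: acts_on_def)

lemma acts_on_mult:
  "acts_on G S \<phi> \<Longrightarrow> g \<in> carrier G \<Longrightarrow> h \<in> carrier G \<Longrightarrow> x \<in> S \<Longrightarrow> \<phi> (g \<otimes>\<^bsub>G\<^esub> h) x = \<phi> g (\<phi> h x)"
  by (simp add: acts_on_def)

lemma acts_on_cancel:
  assumes "group G" "acts_on G S \<phi>" "g \<in> carrier G" "x \<in> S"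
  shows "\<phi> (inv\<^bsub>G\<^esub> g) (\<phi> g x) = x" "\<phi> g (\<phi> (inv\<^bsub>G\<^esub> g) x) = x"
  using assms acts_on_mult[OF assms(2), of "inv\<^bsub>G\<^esub> g" g x] acts_on_mult[OF assms(2), of g "inv\<^bsub>G\<^esub> g" x]
    acts_on_one[OF assms(2,4)] by (simp_all add: group.l_inv group.r_inv)

lemma acts_on_inj:
  assumes "group G" "acts_on G S \<phi>" "g \<in> carrier G"
  shows "inj_on (\<phi> g) S"
  using acts_on_cancel(1)[OF assms] by (metis inj_onI)

lemma acts_on_image:
  assumes "acts_on G S \<phi>" "g \<in> carrier G" "A \<subseteq> S"
  shows "\<phi> g ` A \<subseteq> S"
  using assms acts_on_closed by fastforce

lemma group_action_imp_acts_on: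
  assumes "group_action G S \<phi>"
  shows "acts_on G S \<phi>"
proof -
  interpret group_action G S \<phi> by fact
  show ?thesis
    using group_action_closed[OF assms] composition_rule
    by (intro acts_onI) (auto simp flip: id_eq_one)
qed

lemma acts_on_imp_group_action:
  assumes G: "group G" and act: "acts_on G S \<phi>"
  shows "group_action G S (\<lambda>g. restrict (\<phi> g) S)"
proof -
  have Bij: "restrict (\<phi> g) S \<in> Bij S" if g: "g \<in> carrier G" for g
  proof -
    have "bij_betw (\<phi> g) S S"
    proof (rule bij_betwI)
      show "\<phi> g \<in> S \<rightarrow> S" "\<phi> (inv\<^bsub>G\<^esub> g) \<in> S \<rightarrow> S"
        using G g acts_on_closed[OF act] by auto
    qed (use acts_on_cancel[OF G act g] in auto)
    then show ?thesis by (simp add: Bij_def)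
  qed
  have "(\<lambda>g. restrict (\<phi> g) S) \<in> hom G (BijGroup S)"
  proof (rule homI)
    fix g h assume "g \<in> carrier G" "h \<in> carrier G"
    then show "restrict (\<phi> (g \<otimes>\<^bsub>G\<^esub> h)) S = restrict (\<phi> g) S \<otimes>\<^bsub>BijGroup S\<^esub> restrict (\<phi> h) S"
      using Bij act by (auto simp: BijGroup_def compose_def acts_on_def fun_eq_iff)
  qed (simp add: BijGroup_def Bij)
  then show ?thesis
    using G group_BijGroup by (simp add: group_action_def group_hom_def group_hom_axioms_def)
qed

definition stable :: "('a, 'm) monoid_scheme \<Rightarrow> ('a \<Rightarrow> 'x \<Rightarrow> 'x) \<Rightarrow> 'x set \<Rightarrow> bool" where
  "stable G \<phi> R \<longleftrightarrow> (\<forall>g\<in>carrier G. \<forall>x\<in>R. \<phi> g x \<in> R)"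

lemma stable_iff:
  assumes "group G" "acts_on G S \<phi>" "stable G \<phi> R" "g \<in> carrier G" "x \<in> S"
  shows "\<phi> g x \<in> R \<longleftrightarrow> x \<in> R"
proof
  assume "\<phi> g x \<in> R"
  then have "\<phi> (inv\<^bsub>G\<^esub> g) (\<phi> g x) \<in> R"
    using assms by (simp add: stable_def)
  then show "x \<in> R"
    using acts_on_cancel(1)[OF assms(1,2,4,5)] by simp
qed (use assms in \<open>simp add: stable_def\<close>)

definition mean_on :: "'x set \<Rightarrow> ('x set \<Rightarrow> real) \<Rightarrow> bool" where
  "mean_on S m \<longleftrightarrow> (\<forall>A\<subseteq>S. 0 \<le> m A) \<and>
     (\<forall>A B. A \<subseteq> S \<longrightarrow> B \<subseteq> S \<longrightarrow> A \<inter> B = {} \<longrightarrow> m (A \<union> B) = m A + m B) \<and> m S = 1"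

lemma mean_on_nonneg: "mean_on S m \<Longrightarrow> A \<subseteq> S \<Longrightarrow> 0 \<le> m A"
  by (simp add: mean_on_def)

lemma mean_on_Un:
  "mean_on S m \<Longrightarrow> A \<subseteq> S \<Longrightarrow> B \<subseteq> S \<Longrightarrow> A \<inter> B = {} \<Longrightarrow> m (A \<union> B) = m A + m B"
  by (simp add: mean_on_def)

lemma mean_on_empty: "mean_on S m \<Longrightarrow> m {} = 0"
  using mean_on_Un[of S m "{}" "{}"] by simp

lemma mean_on_Diff:
  assumes "mean_on S m" "A \<subseteq> B" "B \<subseteq> S"
  shows "m (B - A) = m B - m A"
proof -
  have "A \<union> (B - A) = B" "A \<subseteq> S" "B - A \<subseteq> S" using assms by auto
  then show ?thesis using mean_on_Un[OF assms(1), of A "B - A"] by auto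
qed

lemma mean_on_mono: "mean_on S m \<Longrightarrow> A \<subseteq> B \<Longrightarrow> B \<subseteq> S \<Longrightarrow> m A \<le> m B"
  using mean_on_Diff[of S m A B] mean_on_nonneg[of S m "B - A"] by auto

lemma mean_on_le_1: "mean_on S m \<Longrightarrow> A \<subseteq> S \<Longrightarrow> m A \<le> 1"
  using mean_on_mono[of S m A S] by (simp add: mean_on_def)

lemma mean_on_Int_1:
  assumes m: "mean_on S m" and A: "A \<subseteq> S" "m A = 1" and B: "B \<subseteq> S" "m B = 1"
  shows "m (A \<inter> B) = 1"
proof -
  have "m (B - A) \<le> m (S - A)"
    by (rule mean_on_mono[OF m]) (use B in auto)
  also have "\<dots> = 0" using mean_on_Diff[OF m A(1)] A(2) m by (simp add: mean_on_def)
  finally have "m (B - A) \<le> 0" .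
  moreover have "B - A = B - A \<inter> B" by auto
  then have "m (B - A) = m B - m (A \<inter> B)"
    using mean_on_Diff[OF m, of "A \<inter> B" B] B by simp
  moreover have "m (A \<inter> B) \<le> 1" using A by (intro mean_on_le_1[OF m]) auto
  ultimately show ?thesis using B by simp
qed

lemma mean_on_INT_1:
  assumes m: "mean_on S m" and D: "finite D" and A: "\<And>d. d \<in> D \<Longrightarrow> A d \<subseteq> S \<and> m (A d) = 1"
  shows "m (S \<inter> (\<Inter>d\<in>D. A d)) = 1"
  using D A
proof (induction D)
  case empty
  then show ?case using m by (simp add: mean_on_def)
next
  case (insert d D)
  then have "m (A d \<inter> (S \<inter> (\<Inter>d\<in>D. A d))) = 1"
    by (intro mean_on_Int_1[OF m, of "A d"]) (simp_all add: le_infI1)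
  moreover have "S \<inter> (\<Inter>d\<in>insert d D. A d) = A d \<inter> (S \<inter> (\<Inter>d\<in>D. A d))" by auto
  ultimately show ?case by simp
qed

lemma mean_on_UN:
  assumes m: "mean_on S m" and D: "finite D" and A: "\<And>d. d \<in> D \<Longrightarrow> A d \<subseteq> S"
    and disj: "disjoint_family_on A D"
  shows "m (\<Union>d\<in>D. A d) = (\<Sum>d\<in>D. m (A d))"
  using D A disj
proof (induction D)
  case empty
  then show ?case using mean_on_empty[OF m] by simp
next
  case (insert d D)
  have "m (A d \<union> (\<Union>d\<in>D. A d)) = m (A d) + m (\<Union>d\<in>D. A d)"
    using insert by (intro mean_on_Un[OF m]) (auto simp: disjoint_family_on_def)
  moreover have "disjoint_family_on A D"
    using insert.prems by (auto simp: disjoint_family_on_def)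
  ultimately show ?case using insert by simp
qed

lemma invariant_mean_iff:
  "invariant_mean G S \<phi> m \<longleftrightarrow>
     mean_on S m \<and> (\<forall>g\<in>carrier G. \<forall>A. A \<subseteq> S \<longrightarrow> m (\<phi> g ` A) = m A)"
  using mean_on_le_1[of S m] by (auto simp: invariant_mean_def mean_on_def)

lemma invariant_mean_mean_on: "invariant_mean G S \<phi> m \<Longrightarrow> mean_on S m"
  by (simp add: invariant_mean_iff)

lemma invariant_mean_image:
  "invariant_mean G S \<phi> m \<Longrightarrow> g \<in> carrier G \<Longrightarrow> A \<subseteq> S \<Longrightarrow> m (\<phi> g ` A) = m A"
  by (simp add: invariant_mean_iff)

text \<open>
  One inequality suffices, since it may also be applied to the inverse of \<open>g\<close>.
\<close>

lemma invariant_meanI_le: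
  assumes G: "group G" and act: "acts_on G S \<phi>" and m: "mean_on S m"
    and le: "\<And>g A. g \<in> carrier G \<Longrightarrow> A \<subseteq> S \<Longrightarrow> m A \<le> m (\<phi> g ` A)"
  shows "invariant_mean G S \<phi> m"
  unfolding invariant_mean_iff
proof (intro conjI m ballI allI impI)
  fix g A assume g: "g \<in> carrier G" and A: "A \<subseteq> S"
  have "\<phi> (inv\<^bsub>G\<^esub> g) ` \<phi> g ` A = A"
    using acts_on_cancel(1)[OF G act g] A by (force simp: image_image)
  then have "m (\<phi> g ` A) \<le> m A"
    using le[of "inv\<^bsub>G\<^esub> g" "\<phi> g ` A"] G g acts_on_image[OF act g A] by simp
  with le[OF g A] show "m (\<phi> g ` A) = m A" by simp
qed

lemma amenable_actionI:
  assumes "group G" "acts_on G S \<phi>" "invariant_mean G S \<phi> m"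
  shows "amenable_action G S (\<lambda>g. restrict (\<phi> g) S)"
proof -
  have "restrict (\<phi> g) S ` A = \<phi> g ` A" if "A \<subseteq> S" for g A
    using that by (auto simp: image_iff subset_iff)
  then have "invariant_mean G S (\<lambda>g. restrict (\<phi> g) S) m"
    using assms(3) by (simp add: invariant_mean_iff)
  then show ?thesis
    using acts_on_imp_group_action[OF assms(1,2)] by (auto simp: amenable_action_def)
qed

lemma acts_on_transport:
  assumes act: "acts_on G S \<phi>" and f: "inj_on f S"
  shows "acts_on G (f ` S) (transport_action S f \<phi>)"
  using act by (intro acts_onI)
    (auto simp: transport_action_apply[OF f] acts_on_def)

section \<open>Limits of means\<close>

text \<open>
  By compactness of the cube \<open>[0,1]\<close> to the power of the index set, the sequence \<open>f\<close> has a
  cluster point \<open>L\<close>, and \<open>F\<close> collects the indices near which \<open>f\<close> is close to \<open>L\<close>. It does the work of an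
  ultrafilter: all the sequences \<open>f n b\<close> converge along it simultaneously. If the \<open>f n\<close> are means,
  then so is \<open>L\<close>, because finite additivity and normalisation pass to limits.
\<close>

lemma tendsto_along_finer_filter:
  fixes f :: "nat \<Rightarrow> 'b \<Rightarrow> real"
  assumes f: "\<And>n b. 0 \<le> f n b \<and> f n b \<le> 1"
  obtains F L where "F \<noteq> bot" "F \<le> sequentially" "\<And>b. ((\<lambda>n. f n b) \<longlongrightarrow> L b) F"
proof -
  have "compactin (product_topology (\<lambda>b. euclidean) UNIV) (PiE UNIV (\<lambda>b::'b. {0..1::real}))"
    by (subst compactin_PiE) auto
  then have "compact (PiE UNIV (\<lambda>b::'b. {0..1::real}))"
    by (simp add: euclidean_product_topology)
  moreover have "eventually (\<lambda>x. x \<in> PiE UNIV (\<lambda>b::'b. {0..1::real})) (filtermap f sequentially)"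
    using f by (simp add: eventually_filtermap PiE_UNIV_domain)
  moreover have "filtermap f sequentially \<noteq> bot"
    by (simp add: filtermap_bot_iff)
  ultimately obtain L where L: "inf (nhds L) (filtermap f sequentially) \<noteq> bot"
    unfolding compact_filter by blast
  define F where "F = inf sequentially (filtercomap f (nhds L))"
  have "filtermap f F \<le> nhds L"
    unfolding F_def by (rule filtermap_le_iff_le_filtercomap[THEN iffD2]) simp
  then have lim: "(f \<longlongrightarrow> L) F" by (simp add: filterlim_def)
  have "F \<noteq> bot"
  proof
    assume "F = bot"
    then have "eventually (\<lambda>_. False) F" by simp
    then obtain P Q where PQ: "eventually P sequentially" "eventually Q (filtercomap f (nhds L))"
        "\<And>n. P n \<Longrightarrow> Q n \<Longrightarrow> False"
      unfolding F_def eventually_inf by blast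
    obtain R where R: "eventually R (nhds L)" "\<And>n. R (f n) \<Longrightarrow> Q n"
      using PQ(2) unfolding eventually_filtercomap by blast
    have "eventually (\<lambda>n. \<not> R (f n)) sequentially"
      using PQ(1) by eventually_elim (use PQ(3) R(2) in blast)
    then have "eventually (\<lambda>x. \<not> R x) (filtermap f sequentially)"
      by (simp add: eventually_filtermap)
    with R(1) have "eventually (\<lambda>_. False) (inf (nhds L) (filtermap f sequentially))"
      unfolding eventually_inf by blast
    then show False using L by (simp add: eventually_False)
  qed
  moreover have "F \<le> sequentially" by (simp add: F_def)
  moreover have "((\<lambda>n. f n b) \<longlongrightarrow> L b) F" for b
  proof -
    have "continuous_on UNIV (\<lambda>x::'b \<Rightarrow> real. x b)" by (intro continuous_on_product_coordinates)
    from continuous_on_tendsto_compose[OF this lim] show ?thesis by simp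
  qed
  ultimately show ?thesis using that by blast
qed

section \<open>Null sets that meet every orbit\<close>

definition orbit_of :: "('a, 'm) monoid_scheme \<Rightarrow> ('a \<Rightarrow> 'x \<Rightarrow> 'x) \<Rightarrow> 'x \<Rightarrow> 'x set" where
  "orbit_of G \<phi> x = (\<lambda>g. \<phi> g x) ` carrier G"

lemma orbit_of_subset: "acts_on G X \<phi> \<Longrightarrow> x \<in> X \<Longrightarrow> orbit_of G \<phi> x \<subseteq> X"
  by (auto simp: orbit_of_def acts_on_def)

lemma orbit_of_refl: "group G \<Longrightarrow> acts_on G X \<phi> \<Longrightarrow> x \<in> X \<Longrightarrow> x \<in> orbit_of G \<phi> x"
  unfolding orbit_of_def
  by (rule image_eqI[of _ _ "\<one>\<^bsub>G\<^esub>"]) (simp_all add: acts_on_one monoid.one_closed[OF group.is_monoid])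

lemma stable_orbit_of:
  "group G \<Longrightarrow> acts_on G X \<phi> \<Longrightarrow> x \<in> X \<Longrightarrow> stable G \<phi> (orbit_of G \<phi> x)"
  unfolding stable_def orbit_of_def
  by (auto simp flip: acts_on_mult intro!: imageI monoid.m_closed[OF group.is_monoid])

lemma orbit_of_subset_stable: "stable G \<phi> R \<Longrightarrow> x \<in> R \<Longrightarrow> orbit_of G \<phi> x \<subseteq> R"
  by (auto simp: orbit_of_def stable_def)

lemma orbit_of_eq:
  assumes G: "group G" and act: "acts_on G X \<phi>" and x: "x \<in> X" and y: "y \<in> orbit_of G \<phi> x"
  shows "orbit_of G \<phi> y = orbit_of G \<phi> x"
proof
  show "orbit_of G \<phi> y \<subseteq> orbit_of G \<phi> x"
    by (intro orbit_of_subset_stable stable_orbit_of[OF G act] x y)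
  obtain g where g: "g \<in> carrier G" "y = \<phi> g x" using y by (auto simp: orbit_of_def)
  have "y \<in> X" using orbit_of_subset[OF act x] y by blast
  moreover have "x \<in> orbit_of G \<phi> y"
    unfolding orbit_of_def using g acts_on_cancel(1)[OF G act g(1) x] G
    by (intro image_eqI[of _ _ "inv\<^bsub>G\<^esub> g"]) simp_all
  ultimately show "orbit_of G \<phi> x \<subseteq> orbit_of G \<phi> y"
    by (intro orbit_of_subset_stable stable_orbit_of[OF G act])
qed

text \<open>
  That \<open>T\<close> meets every orbit is expressed through stable sets, because this form also makes sense
  for two groups acting jointly. The points are pairs since the set will be a disjoint union of
  countably many sets of numbers.
\<close>

definition has_null_sweep :: "('a, 'm) monoid_scheme \<Rightarrow> bool" where
  "has_null_sweep G \<longleftrightarrow> (\<exists>(X :: (nat \<times> nat) set) \<phi> m T.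
     acts_on G X \<phi> \<and> invariant_mean G X \<phi> m \<and> T \<subseteq> X \<and> m T = 0 \<and>
     (\<forall>R\<subseteq>X. R \<noteq> {} \<longrightarrow> stable G \<phi> R \<longrightarrow> R \<inter> T \<noteq> {}))"

definition amenable_with_orbits_ge :: "('a, 'm) monoid_scheme \<Rightarrow> nat \<Rightarrow> bool" where
  "amenable_with_orbits_ge G n \<longleftrightarrow> (\<exists>(X :: nat set) \<phi> m.
     acts_on G X \<phi> \<and> invariant_mean G X \<phi> m \<and>
     (\<forall>x\<in>X. \<exists>e. inj_on e {..<n} \<and> e ` {..<n} \<subseteq> orbit_of G \<phi> x))"

text \<open>
  With at least \<open>n\<close> points in every orbit there are \<open>n\<close> disjoint sets that meet every orbit in
  one point. Their means add up to at most 1, so one of them has mean at most \<open>1/n\<close>.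
\<close>

lemma small_transversal:
  assumes G: "group G" and act: "acts_on G X \<phi>" and m: "mean_on X m" and n: "0 < n"
    and large: "\<And>x. x \<in> X \<Longrightarrow> \<exists>e. inj_on e {..<n::nat} \<and> e ` {..<n} \<subseteq> orbit_of G \<phi> x"
  obtains T where "T \<subseteq> X" "m T \<le> 1 / n" "\<And>x. x \<in> X \<Longrightarrow> orbit_of G \<phi> x \<inter> T \<noteq> {}"
proof -
  define Os where "Os = orbit_of G \<phi> ` X"
  have "\<exists>e. inj_on e {..<n} \<and> e ` {..<n} \<subseteq> Ob" if "Ob \<in> Os" for Ob
    using that large by (auto simp: Os_def)
  then obtain e where e: "\<And>Ob. Ob \<in> Os \<Longrightarrow> inj_on (e Ob) {..<n} \<and> e Ob ` {..<n} \<subseteq> Ob"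
    by metis
  have sub: "Ob \<subseteq> X" if "Ob \<in> Os" for Ob
    using that orbit_of_subset[OF act] by (auto simp: Os_def)
  have disj: "Ob = Ob'" if O: "Ob \<in> Os" "Ob' \<in> Os" and y: "y \<in> Ob" "y \<in> Ob'" for Ob Ob' y
    using that orbit_of_eq[OF G act] unfolding Os_def by blast
  define T where "T j = (\<lambda>Ob. e Ob j) ` Os" for j
  have T: "T j \<subseteq> X" if "j < n" for j
    using that e sub by (fastforce simp: T_def)
  have "T i \<inter> T j = {}" if "i < n" "j < n" "i \<noteq> j" for i j
  proof (rule ccontr)
    assume "T i \<inter> T j \<noteq> {}"
    then obtain Ob Ob' where O: "Ob \<in> Os" "Ob' \<in> Os" "e Ob i = e Ob' j"
      by (auto simp: T_def)
    moreover have "e Ob i \<in> Ob" "e Ob' j \<in> Ob'" using O e that by blast+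
    ultimately have "Ob = Ob'" using disj by metis
    then show False using O e[of Ob] that by (auto dest: inj_onD)
  qed
  then have "disjoint_family_on T {..<n}" by (simp add: disjoint_family_on_def)
  then have "(\<Sum>j<n. m (T j)) = m (\<Union>j<n. T j)"
    using T by (intro mean_on_UN[OF m, symmetric]) auto
  also have "\<dots> \<le> 1" using T by (intro mean_on_le_1[OF m]) auto
  finally have le: "(\<Sum>j<n. m (T j)) \<le> 1" .
  have "\<exists>j<n. m (T j) \<le> 1 / n"
  proof (rule ccontr)
    assume "\<not> (\<exists>j<n. m (T j) \<le> 1 / n)"
    then have "(\<Sum>j<n. 1 / real n) < (\<Sum>j<n. m (T j))"
      using n by (intro sum_strict_mono) auto
    with le n show False by simp
  qed
  then obtain j where j: "j < n" "m (T j) \<le> 1 / n" by blast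
  have "orbit_of G \<phi> x \<inter> T j \<noteq> {}" if "x \<in> X" for x
    using that j(1) e[of "orbit_of G \<phi> x"] by (auto simp: Os_def T_def)
  with j T that show ?thesis by blast
qed

text \<open>
  Put amenable actions with larger and larger orbits side by side, and let the mean be a limit of
  the means on the slices. A limit sees only slices of large index, where there is a transversal of
  small mean, so the union of these transversals is null.
\<close>

lemma has_null_sweepI:
  assumes G: "group G" and large: "\<And>n. amenable_with_orbits_ge G n"
  shows "has_null_sweep G"
proof -
  have "\<exists>(Y :: nat set) \<phi> m T. acts_on G Y \<phi> \<and> invariant_mean G Y \<phi> m \<and>
      T \<subseteq> Y \<and> m T \<le> 1 / Suc n \<and> (\<forall>x\<in>Y. orbit_of G \<phi> x \<inter> T \<noteq> {})" for n
  proof -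
    obtain Y :: "nat set" and \<phi> m where Y: "acts_on G Y \<phi>" "invariant_mean G Y \<phi> m"
        "\<And>x. x \<in> Y \<Longrightarrow> \<exists>e. inj_on e {..<Suc n} \<and> e ` {..<Suc n} \<subseteq> orbit_of G \<phi> x"
      using large[of "Suc n"] unfolding amenable_with_orbits_ge_def by blast
    from small_transversal[OF G Y(1) invariant_mean_mean_on[OF Y(2)] _ Y(3)] Y(1,2)
    show ?thesis by (metis zero_less_Suc)
  qed
  then obtain Y :: "nat \<Rightarrow> nat set" and \<phi> \<mu> T where Y: "\<And>n. acts_on G (Y n) (\<phi> n)"
      "\<And>n. invariant_mean G (Y n) (\<phi> n) (\<mu> n)" "\<And>n. T n \<subseteq> Y n" "\<And>n. \<mu> n (T n) \<le> 1 / Suc n"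
      "\<And>n x. x \<in> Y n \<Longrightarrow> orbit_of G (\<phi> n) x \<inter> T n \<noteq> {}"
    by metis
  have mean: "mean_on (Y n) (\<mu> n)" for n using Y(2) by (rule invariant_mean_mean_on)
  define X where "X = Sigma UNIV Y"
  define \<psi> where "\<psi> g x = (fst x, \<phi> (fst x) g (snd x))" for g x
  define f where "f n A = \<mu> n (Y n \<inter> Pair n -` A)" for n A
  have "0 \<le> f n A \<and> f n A \<le> 1" for n A
    using mean_on_nonneg[OF mean] mean_on_le_1[OF mean] by (simp add: f_def)
  then obtain F m where F: "F \<noteq> bot" "F \<le> sequentially" and lim: "\<And>A. ((\<lambda>n. f n A) \<longlongrightarrow> m A) F"
    using tendsto_along_finer_filter[of f] by metis
  have meq: "m A = b" if "((\<lambda>n. f n A) \<longlongrightarrow> b) F" for A b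
    using tendsto_unique[OF F(1) lim that] .
  have act: "acts_on G X \<psi>"
    using Y(1) by (intro acts_onI) (auto simp: X_def \<psi>_def acts_on_def)
  have "invariant_mean G X \<psi> m"
    unfolding invariant_mean_iff mean_on_def
  proof (intro conjI allI impI ballI)
    fix A show "0 \<le> m A"
      using lim by (rule tendsto_lowerbound) (use F(1) mean_on_nonneg[OF mean] in \<open>auto simp: f_def\<close>)
  next
    fix A B :: "(nat \<times> nat) set" assume "A \<inter> B = {}"
    then have "f n (A \<union> B) = f n A + f n B" for n
      unfolding f_def by (subst mean_on_Un[OF mean, symmetric]) (auto intro!: arg_cong[where f = "\<mu> n"])
    then show "m (A \<union> B) = m A + m B"
      by (intro meq) (simp add: tendsto_add lim)
  next
    have "f n X = 1" for n
      using mean[of n] by (simp add: f_def X_def vimage_def mean_on_def)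
    then show "m X = 1" by (intro meq) simp
  next
    fix g A assume g: "g \<in> carrier G" and A: "A \<subseteq> X"
    have "Y n \<inter> Pair n -` \<psi> g ` A = \<phi> n g ` (Y n \<inter> Pair n -` A)" for n
      using A acts_on_closed[OF Y(1) g] by (force simp: \<psi>_def X_def)
    then have "f n (\<psi> g ` A) = f n A" for n
      unfolding f_def using invariant_mean_image[OF Y(2) g] by simp
    then show "m (\<psi> g ` A) = m A" by (intro meq) (simp add: lim)
  qed
  moreover have "Sigma UNIV T \<subseteq> X" using Y(3) by (auto simp: X_def)
  moreover have "m (Sigma UNIV T) = 0"
  proof (rule meq)
    have "f n (Sigma UNIV T) = \<mu> n (T n)" for n
      using Y(3) by (auto simp: f_def vimage_def intro!: arg_cong[where f = "\<mu> n"])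
    then have "0 \<le> f n (Sigma UNIV T) \<and> f n (Sigma UNIV T) \<le> inverse (real (Suc n))" for n
      using Y(4) mean_on_nonneg[OF mean Y(3)] by (simp add: inverse_eq_divide)
    then have "(\<lambda>n. f n (Sigma UNIV T)) \<longlonglongrightarrow> 0"
      by (intro tendsto_sandwich[OF _ _ tendsto_const LIMSEQ_inverse_real_of_nat]) auto
    then show "((\<lambda>n. f n (Sigma UNIV T)) \<longlongrightarrow> 0) F"
      using F(2) by (metis tendsto_mono)
  qed
  moreover have "R \<inter> Sigma UNIV T \<noteq> {}" if R: "R \<subseteq> X" "R \<noteq> {}" "stable G \<psi> R" for R
  proof -
    obtain n y where ny: "(n, y) \<in> R" using R(2) by auto
    then have "y \<in> Y n" using R(1) by (auto simp: X_def)
    then obtain g where "g \<in> carrier G" "\<phi> n g y \<in> T n"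
      using Y(5) by (force simp: orbit_of_def)
    moreover have "(n, \<phi> n g y) \<in> R" if "g \<in> carrier G" for g
      using R(3) ny that by (force simp: stable_def \<psi>_def)
    ultimately show ?thesis by blast
  qed
  ultimately show ?thesis
    using act unfolding has_null_sweep_def by blast
qed

section \<open>Groups without the fixed point property\<close>

lemma amenable_with_orbits_geI:
  fixes X :: "'x::countable set"
  assumes G: "group G" and act: "acts_on G X \<phi>" and m: "invariant_mean G X \<phi> m"
    and large: "\<And>x. x \<in> X \<Longrightarrow> \<exists>e. inj_on e {..<n::nat} \<and> e ` {..<n} \<subseteq> orbit_of G \<phi> x"
  shows "amenable_with_orbits_ge G n"
proof -
  let ?\<psi> = "transport_action X to_nat \<phi>"
  have inj: "inj_on to_nat X" by (simp add: inj_on_def)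
  have act': "acts_on G (to_nat ` X) ?\<psi>" by (rule acts_on_transport[OF act inj])
  have "amenable_action G (to_nat ` X) (transport_action X to_nat (\<lambda>g. restrict (\<phi> g) X))"
    by (rule amenable_action_transport[OF amenable_actionI[OF G act m] inj])
  then obtain m' where "invariant_mean G (to_nat ` X) (transport_action X to_nat (\<lambda>g. restrict (\<phi> g) X)) m'"
    by (auto simp: amenable_action_def)
  moreover have "transport_action X to_nat (\<lambda>g. restrict (\<phi> g) X) = ?\<psi>"
    by (auto simp: transport_action_def fun_eq_iff inv_into_into)
  ultimately have m': "invariant_mean G (to_nat ` X) ?\<psi> m'" by simp
  have "\<exists>e. inj_on e {..<n} \<and> e ` {..<n} \<subseteq> orbit_of G ?\<psi> x" if x: "x \<in> to_nat ` X" for x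
  proof -
    obtain y where y: "y \<in> X" "x = to_nat y" using x by blast
    then obtain e where e: "inj_on e {..<n}" "e ` {..<n} \<subseteq> orbit_of G \<phi> y" using large by blast
    have "orbit_of G ?\<psi> x = to_nat ` orbit_of G \<phi> y"
      using y by (simp add: orbit_of_def image_image transport_action_apply[OF inj])
    then have "(to_nat \<circ> e) ` {..<n} \<subseteq> orbit_of G ?\<psi> x" using image_mono[OF e(2), of to_nat] by (simp add: image_image)
    moreover have "inj_on (to_nat \<circ> e) {..<n}" using e(1) by (simp add: inj_on_def)
    ultimately show ?thesis by blast
  qed
  with act' m' show ?thesis unfolding amenable_with_orbits_ge_def by blast
qed

lemma infinite_has_n_points:
  assumes "infinite A"
  obtains e where "inj_on e {..<n::nat}" "e ` {..<n} \<subseteq> A"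
proof -
  obtain e :: "nat \<Rightarrow> 'a" where "inj e" "range e \<subseteq> A" using assms infinite_countable_subset by blast
  with that[of e] show ?thesis by (meson image_mono inj_on_subset order_trans subset_UNIV)
qed

definition transitive_of_degree :: "('a, 'm) monoid_scheme \<Rightarrow> nat \<Rightarrow> bool" where
  "transitive_of_degree G k \<longleftrightarrow> (\<exists>\<phi>. acts_on G {..<k} \<phi> \<and> (\<forall>x<k. \<forall>y<k. \<exists>g\<in>carrier G. \<phi> g x = y))"

lemma transitive_of_degree_card_orbit:
  assumes G: "group G" and act: "acts_on G X \<phi>" and x: "x \<in> X" and fin: "finite (orbit_of G \<phi> x)"
  shows "transitive_of_degree G (card (orbit_of G \<phi> x))"
proof -
  let ?O = "orbit_of G \<phi> x"
  obtain f where f: "bij_betw f ?O {0..<card ?O}" using ex_bij_betw_finite_nat[OF fin] by blast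
  then have inj: "inj_on f ?O" and im: "f ` ?O = {..<card ?O}"
    by (auto simp: bij_betw_def)
  have stable: "\<phi> g y \<in> ?O" if "g \<in> carrier G" "y \<in> ?O" for g y
    using that stable_orbit_of[OF G act x] by (simp add: stable_def)
  have actO: "acts_on G ?O \<phi>"
    using act stable orbit_of_subset[OF act x] by (intro acts_onI) (auto simp: acts_on_def)
  have "\<exists>g\<in>carrier G. transport_action ?O f \<phi> g a = b" if "a < card ?O" "b < card ?O" for a b
  proof -
    from that obtain y z where yz: "y \<in> ?O" "z \<in> ?O" "a = f y" "b = f z"
      using im by (metis imageE lessThan_iff)
    then have "z \<in> orbit_of G \<phi> y" using orbit_of_eq[OF G act x] by blast
    then obtain g where "g \<in> carrier G" "z = \<phi> g y" by (auto simp: orbit_of_def)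
    with yz show ?thesis using transport_action_apply[OF inj yz(1)] by metis
  qed
  then show ?thesis
    using acts_on_transport[OF actO inj] unfolding transitive_of_degree_def im by blast
qed

lemma not_property_F_obtain:
  assumes "\<not> property_F G"
  obtains Y :: "nat set" and \<psi> m where "acts_on G Y \<psi>" "invariant_mean G Y \<psi> m" 
    "\<And>y. y \<in> Y \<Longrightarrow> \<exists>g\<in>carrier G. \<psi> g y \<noteq> y"
proof -
  obtain Y :: "nat set" and \<psi> where "amenable_action G Y \<psi>" "\<not> (\<exists>y\<in>Y. \<forall>g\<in>carrier G. \<psi> g y = y)"
    using assms unfolding property_F_def by blast
  moreover from this obtain m where "acts_on G Y \<psi>" "invariant_mean G Y \<psi> m"
    using group_action_imp_acts_on[of G Y \<psi>] by (auto simp: amenable_action_def)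
  ultimately show ?thesis by (intro that) blast+
qed

text \<open>
  In an amenable action without fixed points, either some orbit is finite, and then it has at
  least two points, or all orbits are infinite and \<open>has_null_sweepI\<close> applies to this single action.
\<close>

lemma not_F_cases:
  assumes G: "group G" and "\<not> property_F G"
  shows "has_null_sweep G \<or> (\<exists>k\<ge>2. transitive_of_degree G k)"
proof -
  obtain Y :: "nat set" and \<psi> m where Y: "acts_on G Y \<psi>" "invariant_mean G Y \<psi> m" 
    "\<And>y. y \<in> Y \<Longrightarrow> \<exists>g\<in>carrier G. \<psi> g y \<noteq> y"
    by (rule not_property_F_obtain[OF assms(2)]) blast
  show ?thesis
  proof (cases "\<exists>y\<in>Y. finite (orbit_of G \<psi> y)")
    case True
    then obtain y where y: "y \<in> Y" "finite (orbit_of G \<psi> y)" by blast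
    obtain g where "g \<in> carrier G" "\<psi> g y \<noteq> y" using Y(3) y by blast
    then have "{y, \<psi> g y} \<subseteq> orbit_of G \<psi> y" "card {y, \<psi> g y} = 2"
      using orbit_of_refl[OF G Y(1) y(1)] by (auto simp: orbit_of_def)
    then have "2 \<le> card (orbit_of G \<psi> y)" using card_mono[OF y(2)] by metis
    then show ?thesis using transitive_of_degree_card_orbit[OF G Y(1) y] by blast
  next
    case False
    then have "\<exists>e. inj_on e {..<n::nat} \<and> e ` {..<n} \<subseteq> orbit_of G \<psi> y" if "y \<in> Y" for n y
      using that infinite_has_n_points by metis
    then have "amenable_with_orbits_ge G n" for n
      by (rule amenable_with_orbits_geI[OF G Y(1,2)])
    then show ?thesis using has_null_sweepI[OF G] by blast
  qed
qed

lemma finite_index_stabilizer: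
  fixes G (structure)
  assumes G: "group G" and act: "acts_on G S \<phi>" and S: "finite S" "s \<in> S"
  defines "K \<equiv> {g \<in> carrier G. \<phi> g s = s}"
  shows "subgroup K G" "finite (rcosets\<^bsub>G\<^esub> K)"
proof -
  interpret group G by fact
  show K: "subgroup K G"
  proof (rule subgroupI)
    fix g assume "g \<in> K"
    then show "inv g \<in> K" using acts_on_cancel(1)[OF G act _ S(2), of g] by (simp add: K_def)
  qed (use act S in \<open>auto simp: K_def acts_on_def\<close>)
  \<comment> \<open>The coset \<open>K g\<close> is determined by the point \<open>g\<inverse> s\<close>.\<close>
  have same: "K #> g = K #> h" if gh: "g \<in> carrier G" "h \<in> carrier G" and eq: "\<phi> (inv g) s = \<phi> (inv h) s" for g h
  proof (rule repr_independence[OF _ gh(2) K, symmetric])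
    have "\<phi> (g \<otimes> inv h) s = s"
      using gh S acts_on_mult[OF act] acts_on_cancel[OF G act] eq by (metis inv_closed)
    then have "g \<otimes> inv h \<in> K" using gh by (simp add: K_def)
    moreover have "g = (g \<otimes> inv h) \<otimes> h" using gh by (simp add: m_assoc)
    ultimately show "g \<in> K #> h" unfolding r_coset_def by blast
  qed
  define r where "r t = (SOME g. g \<in> carrier G \<and> \<phi> (inv g) s = t)" for t
  have "K #> g \<in> (\<lambda>t. K #> r t) ` S" if g: "g \<in> carrier G" for g
  proof (rule image_eqI)
    show "\<phi> (inv g) s \<in> S" using g S act by (simp add: acts_on_closed)
    have "r (\<phi> (inv g) s) \<in> carrier G \<and> \<phi> (inv (r (\<phi> (inv g) s))) s = \<phi> (inv g) s"
      unfolding r_def by (rule someI[of _ g]) (use g in simp)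
    then show "K #> g = K #> r (\<phi> (inv g) s)" using same g by metis
  qed
  then have "rcosets K \<subseteq> (\<lambda>t. K #> r t) ` S"
    by (auto simp: RCOSETS_def)
  then show "finite (rcosets K)" using S(1) finite_surj by blast
qed

text \<open>
  This is the mean on the action of \<open>G\<close> that is induced from an action of a subgroup \<open>K\<close> of
  finite index, written in coordinates: \<open>S\<close> stands for the coset space and \<open>c\<close> for the cocycle
  given by a choice of representatives. The group permutes the fibres, and maps one fibre to
  another through an element of \<open>K\<close>; so averaging the \<open>K\<close>-invariant means of the fibres works.
\<close>

lemma invariant_mean_induced:
  fixes S :: "'s set" and Y :: "'y set"
  assumes G: "group G" and act: "acts_on G S \<sigma>" and S: "finite S" "S \<noteq> {}"
    and Y: "acts_on (G\<lparr>carrier := K\<rparr>) Y \<psi>" "invariant_mean (G\<lparr>carrier := K\<rparr>) Y \<psi> \<mu>"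
    and c: "\<And>g s. g \<in> carrier G \<Longrightarrow> s \<in> S \<Longrightarrow> c g s \<in> K"
  defines "\<tau> \<equiv> \<lambda>g x. (\<sigma> g (fst x), \<psi> (c g (fst x)) (snd x))"
  shows "\<exists>m. invariant_mean G (S \<times> Y) \<tau> m"
proof -
  define m where "m A = (\<Sum>s\<in>S. \<mu> (Y \<inter> Pair s -` A)) / card S" for A
  have \<mu>: "mean_on Y \<mu>" using Y(2) by (rule invariant_mean_mean_on)
  have card: "card S > 0" using S by (simp add: card_gt_0_iff)
  have "invariant_mean G (S \<times> Y) \<tau> m"
    unfolding invariant_mean_iff mean_on_def
  proof (intro conjI allI impI ballI)
    fix A show "0 \<le> m A" by (simp add: m_def sum_nonneg mean_on_nonneg[OF \<mu>])
  next
    fix A B :: "('s \<times> 'y) set" assume "A \<inter> B = {}"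
    then have "\<mu> (Y \<inter> Pair s -` (A \<union> B)) = \<mu> (Y \<inter> Pair s -` A) + \<mu> (Y \<inter> Pair s -` B)" for s
      by (subst mean_on_Un[OF \<mu>, symmetric]) (auto intro!: arg_cong[where f = \<mu>])
    then show "m (A \<union> B) = m A + m B"
      by (simp add: m_def sum.distrib add_divide_distrib)
  next
    have "(\<Sum>s\<in>S. \<mu> (Y \<inter> Pair s -` (S \<times> Y))) = (\<Sum>s\<in>S. 1)"
    proof (rule sum.cong)
      fix s assume "s \<in> S"
      then have "Y \<inter> Pair s -` (S \<times> Y) = Y" by auto
      then show "\<mu> (Y \<inter> Pair s -` (S \<times> Y)) = 1" using \<mu> by (simp add: mean_on_def)
    qed simp
    then show "m (S \<times> Y) = 1" using card by (simp add: m_def)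
  next
    fix g A assume g: "g \<in> carrier G" and A: "A \<subseteq> S \<times> Y"
    have inj: "inj_on (\<sigma> g) S" by (rule acts_on_inj[OF G act g])
    have im: "\<sigma> g ` S = S"
      using acts_on_image[OF act g subset_refl] inj S(1) by (metis endo_inj_surj)
    have "(\<Sum>s\<in>S. \<mu> (Y \<inter> Pair s -` \<tau> g ` A)) = (\<Sum>s\<in>S. \<mu> (Y \<inter> Pair (\<sigma> g s) -` \<tau> g ` A))"
      using sum.reindex[OF inj, of "\<lambda>s. \<mu> (Y \<inter> Pair s -` \<tau> g ` A)"] im by simp
    also have "\<dots> = (\<Sum>s\<in>S. \<mu> (Y \<inter> Pair s -` A))"
    proof (rule sum.cong)
      fix s assume s: "s \<in> S"
      have k: "c g s \<in> carrier (G\<lparr>carrier := K\<rparr>)" using c[OF g s] by simp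
      have "Y \<inter> Pair (\<sigma> g s) -` \<tau> g ` A = \<psi> (c g s) ` (Y \<inter> Pair s -` A)"
      proof (intro equalityI subsetI)
        fix y assume "y \<in> Y \<inter> Pair (\<sigma> g s) -` \<tau> g ` A"
        then obtain t z where t: "(t, z) \<in> A" "\<sigma> g s = \<sigma> g t" "y = \<psi> (c g t) z"
          by (auto simp: \<tau>_def)
        then have "t = s" using inj s A by (auto dest: inj_onD)
        then show "y \<in> \<psi> (c g s) ` (Y \<inter> Pair s -` A)" using t A by auto
      next
        fix y assume "y \<in> \<psi> (c g s) ` (Y \<inter> Pair s -` A)"
        then show "y \<in> Y \<inter> Pair (\<sigma> g s) -` \<tau> g ` A"
          using acts_on_closed[OF Y(1) k] by (force simp: \<tau>_def)
      qed
      then show "\<mu> (Y \<inter> Pair (\<sigma> g s) -` \<tau> g ` A) = \<mu> (Y \<inter> Pair s -` A)"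
        using invariant_mean_image[OF Y(2) k] by simp
    qed simp
    finally show "m (\<tau> g ` A) = m A" by (simp add: m_def)
  qed
  then show ?thesis by blast
qed

lemma invariant_mean_finite:
  assumes "group G" "acts_on G S \<phi>" "finite S" "S \<noteq> {}"
  shows "\<exists>m. invariant_mean G S \<phi> m"
proof -
  have "invariant_mean G S \<phi> (\<lambda>A. card (A \<inter> S) / card S)"
    unfolding invariant_mean_iff mean_on_def
  proof (intro conjI allI impI ballI)
    fix A B assume "A \<subseteq> S" "B \<subseteq> S" "A \<inter> B = {}"
    then have "card ((A \<union> B) \<inter> S) = card (A \<inter> S) + card (B \<inter> S)"
      using assms(3) by (subst card_Un_disjoint[symmetric]) (auto simp: Int_Un_distrib2)
    then show "card ((A \<union> B) \<inter> S) / card S = card (A \<inter> S) / card S + card (B \<inter> S) / card S"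
      by (simp add: add_divide_distrib)
  next
    fix g A assume g: "g \<in> carrier G" and A: "A \<subseteq> S"
    have "\<phi> g ` A \<inter> S = \<phi> g ` A" "A \<inter> S = A"
      using acts_on_image[OF assms(2) g A] A by auto
    then show "card (\<phi> g ` A \<inter> S) / card S = card (A \<inter> S) / card S"
      using card_image[OF inj_on_subset[OF acts_on_inj[OF assms(1,2) g] A]] by simp
  qed (use assms in auto)
  then show ?thesis by blast
qed

lemma transitive_of_degree_imp_orbits_ge:
  assumes G: "group G" and k: "transitive_of_degree G k" "0 < k" "n \<le> k"
  shows "amenable_with_orbits_ge G n"
proof -
  obtain \<phi> where act: "acts_on G {..<k} \<phi>" and tr: "\<forall>x<k. \<forall>y<k. \<exists>g\<in>carrier G. \<phi> g x = y"
    using k(1) by (auto simp: transitive_of_degree_def)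
  obtain m where "invariant_mean G {..<k} \<phi> m"
    using invariant_mean_finite[OF G act] k(2) by auto
  moreover have "inj_on id {..<n}" "id ` {..<n} \<subseteq> orbit_of G \<phi> x" if "x \<in> {..<k}" for x
    using that tr k(3) by (auto simp: orbit_of_def image_iff) (metis dual_order.strict_trans1)
  ultimately show ?thesis
    using act unfolding amenable_with_orbits_ge_def by blast
qed

text \<open>
  If \<open>G\<close> has finite transitive actions of arbitrarily large degree, these will do. Otherwise
  consider one of maximal degree \<open>N\<close> and the stabilizer \<open>K\<close> of a point. This subgroup has an
  amenable action without fixed points; in the induced action of \<open>G\<close> an orbit projects onto the
  \<open>N\<close> points and is not confined to one point in each fibre. A finite orbit would thus be a
  transitive action of degree larger than \<open>N\<close>, so all orbits are infinite.
\<close>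

lemma not_virtually_F_imp_orbits_ge:
  fixes G :: "('a, 'm) monoid_scheme" (structure)
  assumes G: "group G" and nvF: "\<not> virtually_F G"
  shows "amenable_with_orbits_ge G n"
proof (rule ccontr)
  assume not: "\<not> amenable_with_orbits_ge G n"
  interpret group G by fact
  have bound: "k \<le> n" if "transitive_of_degree G k" for k
    using transitive_of_degree_imp_orbits_ge[OF G that, of n] not by linarith
  have one: "transitive_of_degree G 1"
    unfolding transitive_of_degree_def by (rule exI[of _ "\<lambda>_ x. x"]) (auto simp: acts_on_def)
  obtain N where N: "transitive_of_degree G N" and max: "\<And>k. transitive_of_degree G k \<Longrightarrow> k \<le> N"
    using Greatest_le_nat[of "transitive_of_degree G" _ n] GreatestI_nat[of "transitive_of_degree G" 1 n] bound one
    by blast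
  have N0: "0 < N" using max[OF one] by simp
  obtain \<sigma> where \<sigma>: "acts_on G {..<N} \<sigma>" and tr: "\<And>x y. x < N \<Longrightarrow> y < N \<Longrightarrow> \<exists>g\<in>carrier G. \<sigma> g x = y"
    using N by (auto simp: transitive_of_degree_def)
  define K where "K = {g \<in> carrier G. \<sigma> g 0 = 0}"
  have K: "subgroup K G" "finite (rcosets K)"
    using finite_index_stabilizer[OF G \<sigma>, of 0] N0 by (simp_all add: K_def)
  then have "\<not> property_F (G\<lparr>carrier := K\<rparr>)"
    using nvF by (auto simp: virtually_F_def)
  then obtain Y :: "nat set" and \<psi> \<mu> where Y: "acts_on (G\<lparr>carrier := K\<rparr>) Y \<psi>"
      "invariant_mean (G\<lparr>carrier := K\<rparr>) Y \<psi> \<mu>" and moved: "\<And>y. y \<in> Y \<Longrightarrow> \<exists>k\<in>K. \<psi> k y \<noteq> y"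
    by (rule not_property_F_obtain) auto
  obtain r where r: "\<And>s. s < N \<Longrightarrow> r s \<in> carrier G \<and> \<sigma> (r s) 0 = s"
    using tr[OF N0] by metis
  define c where "c g s = inv (r (\<sigma> g s)) \<otimes> g \<otimes> r s" for g s
  define \<tau> where "\<tau> = (\<lambda>g x. (\<sigma> g (fst x), \<psi> (c g (fst x)) (snd x)))"
  have \<sigma>_lt: "\<sigma> g s < N" if "g \<in> carrier G" "s < N" for g s
    using acts_on_closed[OF \<sigma>] that by simp
  have c: "c g s \<in> K" if g: "g \<in> carrier G" and s: "s < N" for g s
  proof -
    have "\<sigma> (c g s) 0 = \<sigma> (inv (r (\<sigma> g s))) (\<sigma> g (\<sigma> (r s) 0))"
      using g s r \<sigma>_lt N0 acts_on_mult[OF \<sigma>] by (simp add: c_def)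
    also have "\<dots> = \<sigma> (inv (r (\<sigma> g s))) (\<sigma> (r (\<sigma> g s)) 0)"
      using r s \<sigma>_lt[OF g s] by simp
    also have "\<dots> = 0"
      using r \<sigma>_lt[OF g s] N0 by (intro acts_on_cancel[OF G \<sigma>]) auto
    finally show ?thesis using g s r \<sigma>_lt by (simp add: K_def c_def)
  qed
  have act: "acts_on G ({..<N} \<times> Y) \<tau>"
  proof (rule acts_onI)
    fix g x assume "g \<in> carrier G" "x \<in> {..<N} \<times> Y"
    then show "\<tau> g x \<in> {..<N} \<times> Y"
      using \<sigma>_lt c acts_on_closed[OF Y(1)] by (auto simp: \<tau>_def)
  next
    fix x assume "x \<in> {..<N} \<times> Y"
    moreover from this have "c \<one> (fst x) = \<one>"
      using r acts_on_one[OF \<sigma>] by (auto simp: c_def)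
    ultimately show "\<tau> \<one> x = x"
      using acts_on_one[OF \<sigma>] acts_on_one[OF Y(1)] by (auto simp: \<tau>_def)
  next
    fix g h x assume gh: "g \<in> carrier G" "h \<in> carrier G" and x: "x \<in> {..<N} \<times> Y"
    obtain s y where sy: "x = (s, y)" "s < N" "y \<in> Y" using x by auto
    have eq: "\<sigma> (g \<otimes> h) s = \<sigma> g (\<sigma> h s)" using acts_on_mult[OF \<sigma>] gh sy by simp
    have "c (g \<otimes> h) s = c g (\<sigma> h s) \<otimes> c h s"
    proof -
      let ?a = "r (\<sigma> g (\<sigma> h s))" and ?b = "r (\<sigma> h s)"
      have cl: "?a \<in> carrier G" "?b \<in> carrier G" "r s \<in> carrier G"
        using r gh sy \<sigma>_lt by auto
      then have "c g (\<sigma> h s) \<otimes> c h s = inv ?a \<otimes> g \<otimes> (?b \<otimes> inv ?b) \<otimes> h \<otimes> r s"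
        using gh unfolding c_def by (simp only: m_assoc m_closed inv_closed)
      then show ?thesis
        using cl gh unfolding c_def eq by (simp add: m_assoc)
    qed
    then show "\<tau> (g \<otimes> h) x = \<tau> g (\<tau> h x)"
      using gh sy eq c \<sigma>_lt acts_on_mult[OF Y(1)] by (simp add: \<tau>_def)
  qed
  obtain m where m: "invariant_mean G ({..<N} \<times> Y) \<tau> m"
    using invariant_mean_induced[OF G \<sigma> _ _ Y, of c] c N0 unfolding \<tau>_def by auto
  have inf: "infinite (orbit_of G \<tau> x)" if x: "x \<in> {..<N} \<times> Y" for x
  proof
    assume fin: "finite (orbit_of G \<tau> x)"
    let ?O = "orbit_of G \<tau> x"
    obtain s y where sy: "x = (s, y)" "s < N" "y \<in> Y" using x by auto
    obtain k where k: "k \<in> K" "\<psi> k y \<noteq> y" using moved sy by blast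
    then have kG: "k \<in> carrier G" "\<sigma> k 0 = 0" by (auto simp: K_def)
    \<comment> \<open>Conjugating \<open>k\<close> into the stabilizer of \<open>s\<close> moves \<open>x\<close> within its fibre.\<close>
    define g where "g = r s \<otimes> k \<otimes> inv (r s)"
    have rs: "r s \<in> carrier G" "\<sigma> (r s) 0 = s" using r sy by auto
    have g: "g \<in> carrier G" using rs kG by (simp add: g_def)
    have "\<sigma> (inv (r s)) s = 0"
      using acts_on_cancel(1)[OF G \<sigma> rs(1), of 0] N0 rs by simp
    then have gs: "\<sigma> g s = s"
      using acts_on_mult[OF \<sigma>] rs kG sy N0 by (simp add: g_def)
    have "c g s = k"
      unfolding c_def gs unfolding g_def using rs kG by (simp add: m_assoc) (simp add: m_assoc[symmetric])
    then have "\<tau> g x = (s, \<psi> k y)" by (simp add: \<tau>_def sy gs)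
    then have "(s, \<psi> k y) \<in> ?O" using g unfolding orbit_of_def by (metis image_eqI)
    moreover have "(s, y) \<in> ?O" using orbit_of_refl[OF G act x] sy by simp
    ultimately have "\<not> inj_on fst ?O" using k(2) inj_onD[of fst ?O "(s, \<psi> k y)" "(s, y)"] by auto
    then have "card (fst ` ?O) < card ?O"
      using fin card_image_le[OF fin] eq_card_imp_inj_on[OF fin] by (metis le_neq_implies_less)
    moreover have "{..<N} \<subseteq> fst ` ?O"
    proof
      fix t assume "t \<in> {..<N}"
      then obtain h where "h \<in> carrier G" "\<sigma> h s = t" using tr sy by auto
      then have "\<tau> h x \<in> ?O" "fst (\<tau> h x) = t" by (auto simp: orbit_of_def \<tau>_def sy)
      then show "t \<in> fst ` ?O" by force
    qed
    then have "N \<le> card (fst ` ?O)" using card_mono[OF finite_imageI[OF fin]] by fastforce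
    moreover have "card ?O \<le> N" by (rule max[OF transitive_of_degree_card_orbit[OF G act x fin]])
    ultimately show False by simp
  qed
  have "amenable_with_orbits_ge G n"
    by (rule amenable_with_orbits_geI[OF G act m]) (metis inf infinite_has_n_points)
  with not show False by simp
qed

section \<open>Symmetry of free products and generation by the factors\<close>

abbreviation swap_word :: "('a + 'b) list \<Rightarrow> ('b + 'a) list" where
  "swap_word \<equiv> map (case_sum Inr Inl)"

lemma swap_word_swap_word: "swap_word (swap_word w) = w"
  by (induction w) (auto split: sum.splits)

lemma fp_letter_swap: "fp_letter H G (case_sum Inr Inl x) = fp_letter G H x"
  by (cases x) auto

lemma swap_word_closed:
  assumes "w \<in> fp_words G H" shows "swap_word w \<in> fp_words H G"
proof -
  have "isl (case_sum Inr Inl x) = (\<not> isl x)" for x :: "'a + 'b" by (cases x) auto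
  then have "map isl (swap_word w) = map Not (map isl w)" for w :: "('a + 'b) list" by simp
  moreover have "distinct_adj (map Not xs) = distinct_adj xs" for xs
    by (rule distinct_adj_map_iff) (auto simp: inj_on_def)
  ultimately show ?thesis using assms by (auto simp: fp_words_def fp_letter_swap simp del: map_map)
qed

lemma swap_fp_cons:
  "fp_cons H G (case_sum Inr Inl x) (swap_word w) = swap_word (fp_cons G H x w)"
  by (cases "(G, H, x, w)" rule: fp_cons.cases) auto

lemma swap_word_mult:
  "swap_word (foldr (fp_cons G H) u v) = foldr (fp_cons H G) (swap_word u) (swap_word v)"
  by (induction u) (simp_all add: swap_fp_cons[symmetric])

lemma swap_word_hom: "swap_word \<in> hom (free_product G H) (free_product H G)"
  by (rule homI) (simp_all add: swap_word_mult swap_word_closed free_product_def)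

lemma countable_group_free_product:
  fixes G :: "('a, 'm) monoid_scheme" and H :: "('b, 'n) monoid_scheme"
  assumes G: "countable_group G" and H: "countable_group H"
  shows "countable_group (free_product G H)"
proof -
  have grp: "group G" "group H" using G H by (auto simp: countable_group_def)
  have "fp_words G H \<subseteq> lists (carrier G <+> carrier H)"
  proof
    fix w assume "w \<in> fp_words G H"
    then have "\<forall>x\<in>set w. fp_letter G H x" by (simp add: fp_words_def)
    moreover have "fp_letter G H x \<Longrightarrow> x \<in> carrier G <+> carrier H" for x by (cases x) auto
    ultimately show "w \<in> lists (carrier G <+> carrier H)" by auto
  qed
  moreover have "countable (carrier G <+> carrier H)"
    using G H by (simp add: countable_group_def)
  ultimately have "countable (fp_words G H)"
    using countable_lists countable_subset by blast
  moreover have "infinite (fp_words G H)"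
  proof
    assume "finite (fp_words G H)"
    moreover have "fp_inl G ` carrier G \<subseteq> fp_words G H"
      by (auto simp: fp_inl_def fp_words_def)
    moreover have "inj_on (fp_inl G :: 'a \<Rightarrow> ('a + 'b) list) (carrier G)"
      by (auto simp: inj_on_def fp_inl_def)
    ultimately have "finite (carrier G)" by (meson finite_imageD finite_subset)
    then show False using G by (simp add: countable_group_def)
  qed
  ultimately show ?thesis
    using group_free_product[OF grp] by (simp add: countable_group_def free_product_def)
qed

lemma in_class_A_swap:
  assumes G: "countable_group G" and H: "countable_group H" and A: "in_class_A (free_product G H)"
  shows "in_class_A (free_product H G)"
proof -
  have grp: "group (free_product H G)" "group (free_product G H)"
    using G H by (auto intro: group_free_product simp: countable_group_def)
  obtain S :: "nat set" and \<Phi> where S: "faithful_action (free_product G H) S \<Phi>"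
      "transitive_action (free_product G H) S \<Phi>" "amenable_action (free_product G H) S \<Phi>"
    using A by (auto simp: in_class_A_def)
  define \<Psi> where "\<Psi> = \<Phi> \<circ> swap_word"
  have closed: "swap_word w \<in> carrier (free_product G H)" if "w \<in> carrier (free_product H G)" for w
    using that swap_word_hom by (auto simp: hom_def)
  have "\<Phi> \<in> hom (free_product G H) (BijGroup S)"
    using S(1) by (simp add: faithful_action_def group_action_def group_hom_def group_hom_axioms_def)
  then have "\<Psi> \<in> hom (free_product H G) (BijGroup S)"
    unfolding \<Psi>_def using swap_word_hom hom_compose by metis
  then have act: "group_action (free_product H G) S \<Psi>"
    using grp group_BijGroup by (simp add: group_action_def group_hom_def group_hom_axioms_def)
  have "inj_on \<Psi> (carrier (free_product H G))"
  proof (rule inj_onI)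
    fix u v assume uv: "u \<in> carrier (free_product H G)" "v \<in> carrier (free_product H G)" "\<Psi> u = \<Psi> v"
    then have "swap_word u = swap_word v"
      using faithful_action.faithful[OF S(1)] closed by (auto simp: \<Psi>_def dest: inj_onD)
    then show "u = v" using swap_word_swap_word by metis
  qed
  then have "faithful_action (free_product H G) S \<Psi>"
    using act by (simp add: faithful_action_def faithful_action_axioms_def)
  moreover have "\<exists>w\<in>carrier (free_product H G). \<Psi> w x = y" if xy: "x \<in> S" "y \<in> S" for x y
  proof -
    obtain w where "w \<in> carrier (free_product G H)" "\<Phi> w x = y"
      using transitive_action.unique_orbit[OF S(2) xy] by blast
    then show ?thesis
      using swap_word_closed[of w G H]
      by (intro bexI[of _ "swap_word w"]) (simp_all only: \<Psi>_def comp_def swap_word_swap_word free_product_def, simp)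
  qed
  then have "transitive_action (free_product H G) S \<Psi>"
    using act by (simp add: transitive_action_def transitive_action_axioms_def)
  moreover have "amenable_action (free_product H G) S \<Psi>"
    using S(3) act closed by (auto simp: amenable_action_def invariant_mean_iff \<Psi>_def)
  ultimately show ?thesis
    using countable_group_free_product[OF H G] by (auto simp: in_class_A_def)
qed

lemma fp_words_tl: "x # w \<in> fp_words G H \<Longrightarrow> w \<in> fp_words G H"
  by (auto simp: fp_words_def distinct_adj_Cons)

lemma fp_cons_reduced: "x # w \<in> fp_words G H \<Longrightarrow> fp_cons G H x w = x # w"
  by (cases x; cases w; cases "hd w") (auto simp: fp_words_def distinct_adj_Cons)

lemma fp_inl_mult: "fp_inl G g \<otimes>\<^bsub>free_product G H\<^esub> w = (if g = \<one>\<^bsub>G\<^esub> then w else fp_cons G H (Inl g) w)"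
  by (simp add: fp_inl_def free_product_def)

lemma fp_inr_mult: "fp_inr H h \<otimes>\<^bsub>free_product G H\<^esub> w = (if h = \<one>\<^bsub>H\<^esub> then w else fp_cons G H (Inr h) w)"
  by (simp add: fp_inr_def free_product_def)

lemma fp_inl_closed: "g \<in> carrier G \<Longrightarrow> fp_inl G g \<in> carrier (free_product G H)"
  by (simp add: fp_inl_def free_product_def fp_words_def)

lemma fp_inr_closed: "h \<in> carrier H \<Longrightarrow> fp_inr H h \<in> carrier (free_product G H)"
  by (simp add: fp_inr_def free_product_def fp_words_def)

lemma free_product_induct [consumes 1, case_names one left right]:
  assumes "w \<in> carrier (free_product G H)"
    and one: "P \<one>\<^bsub>free_product G H\<^esub>"
    and left: "\<And>g w. g \<in> carrier G \<Longrightarrow> w \<in> carrier (free_product G H) \<Longrightarrow> P w \<Longrightarrow>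
      P (fp_inl G g \<otimes>\<^bsub>free_product G H\<^esub> w)"
    and right: "\<And>h w. h \<in> carrier H \<Longrightarrow> w \<in> carrier (free_product G H) \<Longrightarrow> P w \<Longrightarrow>
      P (fp_inr H h \<otimes>\<^bsub>free_product G H\<^esub> w)"
  shows "P w"
  using assms(1)
proof (induction w)
  case Nil
  then show ?case using one by (simp add: free_product_def)
next
  case (Cons x w)
  then have xw: "x # w \<in> fp_words G H" by (simp add: free_product_def)
  then have w: "w \<in> carrier (free_product G H)" using fp_words_tl by (simp add: free_product_def)
  have x: "fp_letter G H x" using xw by (simp add: fp_words_def)
  note red = fp_cons_reduced[OF xw]
  show ?case
  proof (cases x)
    case (Inl g)
    then show ?thesis using left[of g w] x w Cons.IH red by (simp add: fp_inl_mult)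
  next
    case (Inr h)
    then show ?thesis using right[of h w] x w Cons.IH red by (simp add: fp_inr_mult)
  qed
qed

lemma free_product_action:
  fixes G :: "('a, 'm) monoid_scheme" and H :: "('b, 'n) monoid_scheme"
  assumes G: "group G" and H: "group H" and \<phi>: "acts_on G X \<phi>" and \<psi>: "acts_on H X \<psi>"
  obtains \<Phi> where "group_action (free_product G H) X \<Phi>"
    "\<And>g x. g \<in> carrier G \<Longrightarrow> x \<in> X \<Longrightarrow> \<Phi> (fp_inl G g) x = \<phi> g x"
    "\<And>h x. h \<in> carrier H \<Longrightarrow> x \<in> X \<Longrightarrow> \<Phi> (fp_inr H h) x = \<psi> h x"
proof -
  have "(\<lambda>g. restrict (\<phi> g) X) \<in> hom G (BijGroup X)" "(\<lambda>h. restrict (\<psi> h) X) \<in> hom H (BijGroup X)"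
    using acts_on_imp_group_action[OF G \<phi>] acts_on_imp_group_action[OF H \<psi>]
    by (simp_all add: group_action_def group_hom_def group_hom_axioms_def)
  then obtain \<Phi> where \<Phi>: "\<Phi> \<in> hom (free_product G H) (BijGroup X)"
      "\<And>g. g \<in> carrier G \<Longrightarrow> \<Phi> (fp_inl G g) = restrict (\<phi> g) X"
      "\<And>h. h \<in> carrier H \<Longrightarrow> \<Phi> (fp_inr H h) = restrict (\<psi> h) X"
    using free_product_universal[OF G H group_BijGroup] by metis
  then have "group_action (free_product G H) X \<Phi>"
    using group_free_product[OF G H] group_BijGroup
    by (simp add: group_action_def group_hom_def group_hom_axioms_def)
  then show ?thesis using that \<Phi> by simp
qed

lemma invariant_mean_free_product:
  assumes G: "group G" and H: "group H" and act: "group_action (free_product G H) X \<Phi>"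
    and m: "invariant_mean G X (\<lambda>g. \<Phi> (fp_inl G g)) m" "invariant_mean H X (\<lambda>h. \<Phi> (fp_inr H h)) m"
  shows "invariant_mean (free_product G H) X \<Phi> m"
  unfolding invariant_mean_iff
proof (intro conjI ballI allI impI)
  show "mean_on X m" using m(1) by (rule invariant_mean_mean_on)
  fix w A assume w: "w \<in> carrier (free_product G H)" and A: "A \<subseteq> X"
  note acts = group_action_imp_acts_on[OF act]
  have mult: "\<Phi> (u \<otimes>\<^bsub>free_product G H\<^esub> v) ` A = \<Phi> u ` \<Phi> v ` A"
    if "u \<in> carrier (free_product G H)" "v \<in> carrier (free_product G H)" for u v
    using A acts_on_mult[OF acts that] by (force simp: image_image)
  from w show "m (\<Phi> w ` A) = m A"
  proof (induction rule: free_product_induct)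
    case one
    have "\<Phi> \<one>\<^bsub>free_product G H\<^esub> ` A = A" using A acts_on_one[OF acts] by force
    then show ?case by simp
  next
    case (left g w)
    then show ?case
      using mult[OF fp_inl_closed[OF left(1)] left(2)] acts_on_image[OF acts left(2) A]
        invariant_mean_image[OF m(1) left(1)] by simp
  next
    case (right h w)
    then show ?case
      using mult[OF fp_inr_closed[OF right(1)] right(2)] acts_on_image[OF acts right(2) A]
        invariant_mean_image[OF m(2) right(1)] by simp
  qed
qed

lemma stable_free_product:
  assumes act: "group_action (free_product G H) X \<Phi>" and R: "R \<subseteq> X"
    and st: "stable G (\<lambda>g. \<Phi> (fp_inl G g)) R" "stable H (\<lambda>h. \<Phi> (fp_inr H h)) R"
  shows "stable (free_product G H) \<Phi> R"
  unfolding stable_def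
proof (intro ballI)
  fix w x assume w: "w \<in> carrier (free_product G H)" and x: "x \<in> R"
  note acts = group_action_imp_acts_on[OF act]
  from w show "\<Phi> w x \<in> R"
  proof (induction rule: free_product_induct)
    case one
    then show ?case using x R acts_on_one[OF acts] by auto
  next
    case (left g w)
    then show ?case
      using x R acts_on_mult[OF acts fp_inl_closed[OF left(1)] left(2)] st(1) by (auto simp: stable_def)
  next
    case (right h w)
    then show ?case
      using x R acts_on_mult[OF acts fp_inr_closed[OF right(1)] right(2)] st(2) by (auto simp: stable_def)
  qed
qed

section \<open>Attaching a null set to the regular action\<close>

lemma acts_on_regular_left:
  assumes G: "group G" and H: "group H"
  shows "acts_on G (fp_words G H) (\<lambda>g w. fp_inl G g \<otimes>\<^bsub>free_product G H\<^esub> w)"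
proof -
  interpret P: group "free_product G H" by (rule group_free_product[OF G H])
  note cl = fp_inl_closed[of _ G H] 
  have C: "fp_words G H = carrier (free_product G H)" by (simp add: free_product_def)
  have one: "fp_inl G \<one>\<^bsub>G\<^esub> = \<one>\<^bsub>free_product G H\<^esub>" by (simp add: fp_inl_def free_product_def)
  show ?thesis
    unfolding C by (intro acts_onI) (simp_all add: cl one hom_mult[OF fp_inl_hom[OF G H]] P.m_assoc)
qed

lemma acts_on_regular_right:
  assumes G: "group G" and H: "group H"
  shows "acts_on H (fp_words G H) (\<lambda>h w. fp_inr H h \<otimes>\<^bsub>free_product G H\<^esub> w)"
proof -
  interpret P: group "free_product G H" by (rule group_free_product[OF G H])
  note cl = fp_inr_closed[of _ H G] 
  have C: "fp_words G H = carrier (free_product G H)" by (simp add: free_product_def)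
  have one: "fp_inr H \<one>\<^bsub>H\<^esub> = \<one>\<^bsub>free_product G H\<^esub>" by (simp add: fp_inr_def free_product_def)
  show ?thesis
    unfolding C by (intro acts_onI) (simp_all add: cl one hom_mult[OF fp_inr_hom[OF G H]] P.m_assoc)
qed

lemma acts_on_map_sum:
  assumes "acts_on G A \<alpha>" "acts_on G B \<beta>"
  shows "acts_on G (A <+> B) (\<lambda>g. map_sum (\<alpha> g) (\<beta> g))"
  using assms by (intro acts_onI) (auto simp: acts_on_def)

lemma acts_on_replace:
  assumes H: "group H" and \<psi>: "acts_on H Z \<psi>" and C: "C \<subseteq> Z" "stable H \<psi> C" and \<chi>: "acts_on H C \<chi>"
  shows "acts_on H Z (\<lambda>h x. if x \<in> C then \<chi> h x else \<psi> h x)"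
proof (rule acts_onI)
  fix h x assume h: "h \<in> carrier H" and x: "x \<in> Z"
  then show "(if x \<in> C then \<chi> h x else \<psi> h x) \<in> Z"
    using C(1) acts_on_closed[OF \<psi>] acts_on_closed[OF \<chi>] by auto
next
  fix g h x assume "g \<in> carrier H" "h \<in> carrier H" and x: "x \<in> Z"
  then show "(if x \<in> C then \<chi> (g \<otimes>\<^bsub>H\<^esub> h) x else \<psi> (g \<otimes>\<^bsub>H\<^esub> h) x) =
      (if (if x \<in> C then \<chi> h x else \<psi> h x) \<in> C
       then \<chi> g (if x \<in> C then \<chi> h x else \<psi> h x) else \<psi> g (if x \<in> C then \<chi> h x else \<psi> h x))"
    using acts_on_closed[OF \<chi>] acts_on_mult[OF \<psi>] acts_on_mult[OF \<chi>] stable_iff[OF H \<psi> C(2)] by simp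
qed (use assms acts_on_one in auto)

text \<open>
  This is left multiplication, transported along a bijection of \<open>C\<close> with the group.
\<close>

lemma transitive_action_on_countable:
  assumes H: "countable_group H" and C: "countable C" "infinite C"
  obtains \<chi> where "acts_on H C \<chi>" "\<And>x y. x \<in> C \<Longrightarrow> y \<in> C \<Longrightarrow> \<exists>h\<in>carrier H. \<chi> h x = y"
proof -
  interpret group H using H by (simp add: countable_group_def)
  have "bij_betw (to_nat_on C) C UNIV" "bij_betw (from_nat_into (carrier H)) UNIV (carrier H)"
    using H C by (auto simp: countable_group_def intro: to_nat_on_infinite bij_betw_from_nat_into)
  then have b: "bij_betw (from_nat_into (carrier H) \<circ> to_nat_on C) C (carrier H)" (is "bij_betw ?b _ _")
    by (rule bij_betw_trans)
  define a where "a = inv_into C ?b"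
  define b where "b = ?b"
  have ab: "a (b x) = x" "b x \<in> carrier H" if "x \<in> C" for x
    unfolding a_def b_def using b that by (simp_all only: bij_betw_inv_into_left bij_betwE)
  have ba: "b (a h) = h" "a h \<in> C" if "h \<in> carrier H" for h
    unfolding a_def b_def using b that by (simp_all only: bij_betw_inv_into_right bij_betwE[OF bij_betw_inv_into])
  show ?thesis
  proof (rule that[of "\<lambda>h x. a (h \<otimes>\<^bsub>H\<^esub> b x)"])
    show "acts_on H C (\<lambda>h x. a (h \<otimes>\<^bsub>H\<^esub> b x))"
      by (rule acts_onI) (simp_all add: ab ba m_assoc)
    fix x y assume xy: "x \<in> C" "y \<in> C"
    show "\<exists>h\<in>carrier H. a (h \<otimes>\<^bsub>H\<^esub> b x) = y"
      by (rule bexI[of _ "b y \<otimes>\<^bsub>H\<^esub> inv\<^bsub>H\<^esub> b x"]) (simp_all add: xy ab m_assoc)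
  qed
qed

text \<open>
  Suppose that \<open>G\<close> and \<open>H\<close> act on \<open>X\<close> with a common invariant mean, and that \<open>T\<close> is a null set of
  points fixed by \<open>H\<close> that meets every jointly stable set. The action of the free product on its own
  words by multiplication is faithful and transitive, but has no invariant mean. Put it next to
  \<open>X\<close>, as a set of mean zero, and join the two parts in a single place: forget how \<open>H\<close> acts on \<open>T\<close> and
  on the orbit of the empty word, and let \<open>H\<close> permute the union of these two sets, the hub,
  transitively. The mean does not notice the change, as it happens on a null set. Every part of
  \<open>X\<close> becomes connected to the hub through \<open>T\<close>, and reduced words still act nontrivially far away
  from the hub.
\<close>

locale null_attachment =
  fixes G :: "('a, 'm) monoid_scheme" and H :: "('b, 'n) monoid_scheme"
    and X T :: "'x set" and \<phi> \<psi> and m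
  assumes cG: "countable_group G" and cH: "countable_group H"
    and \<phi>: "acts_on G X \<phi>" and \<psi>: "acts_on H X \<psi>"
    and m\<phi>: "invariant_mean G X \<phi> m" and m\<psi>: "invariant_mean H X \<psi> m"
    and T: "T \<subseteq> X" "countable T" "m T = 0"
    and T_fixed: "\<And>h t. h \<in> carrier H \<Longrightarrow> t \<in> T \<Longrightarrow> \<psi> h t = t"
    and T_meets: "\<And>R. R \<subseteq> X \<Longrightarrow> R \<noteq> {} \<Longrightarrow> stable G \<phi> R \<Longrightarrow> stable H \<psi> R \<Longrightarrow> R \<inter> T \<noteq> {}"
begin

lemma G: "group G" and H: "group H"
  using cG cH by (simp_all add: countable_group_def)

definition left_act :: "'a \<Rightarrow> 'x + ('a + 'b) list \<Rightarrow> 'x + ('a + 'b) list" where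
  "left_act g = map_sum (\<phi> g) (\<lambda>w. fp_inl G g \<otimes>\<^bsub>free_product G H\<^esub> w)"

definition right_act0 :: "'b \<Rightarrow> 'x + ('a + 'b) list \<Rightarrow> 'x + ('a + 'b) list" where
  "right_act0 h = map_sum (\<psi> h) (\<lambda>w. fp_inr H h \<otimes>\<^bsub>free_product G H\<^esub> w)"

definition hub :: "('x + ('a + 'b) list) set" where
  "hub = T <+> fp_inr H ` carrier H"

definition regular_on_hub :: "'b \<Rightarrow> 'x + ('a + 'b) list \<Rightarrow> 'x + ('a + 'b) list" where
  "regular_on_hub = (SOME \<chi>. acts_on H hub \<chi> \<and> (\<forall>x\<in>hub. \<forall>y\<in>hub. \<exists>h\<in>carrier H. \<chi> h x = y))"

definition right_act :: "'b \<Rightarrow> 'x + ('a + 'b) list \<Rightarrow> 'x + ('a + 'b) list" where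
  "right_act h x = (if x \<in> hub then regular_on_hub h x else right_act0 h x)"

abbreviation Z :: "('x + ('a + 'b) list) set" where "Z \<equiv> X <+> fp_words G H"

lemma left_act: "acts_on G Z left_act"
  unfolding left_act_def by (rule acts_on_map_sum[OF \<phi> acts_on_regular_left[OF G H]])

lemma right_act0: "acts_on H Z right_act0"
  unfolding right_act0_def by (rule acts_on_map_sum[OF \<psi> acts_on_regular_right[OF G H]])

lemma hub_subset: "hub \<subseteq> Z"
  using T fp_inr_closed[of _ H G] by (auto simp: hub_def free_product_def)

lemma hub_stable: "stable H right_act0 hub"
proof -
  have "fp_inr H h \<otimes>\<^bsub>free_product G H\<^esub> fp_inr H k \<in> fp_inr H ` carrier H"
    if "h \<in> carrier H" "k \<in> carrier H" for h k
    using that hom_mult[OF fp_inr_hom[OF G H]] monoid.m_closed[OF group.is_monoid[OF H]]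
    by (metis imageI)
  then show ?thesis by (auto simp: stable_def right_act0_def hub_def T_fixed)
qed

lemma regular_on_hub:
  "acts_on H hub regular_on_hub" "\<And>x y. x \<in> hub \<Longrightarrow> y \<in> hub \<Longrightarrow> \<exists>h\<in>carrier H. regular_on_hub h x = y"
proof -
  have "countable hub"
    using T cH unfolding hub_def by (intro countable_Plus) (auto simp: countable_group_def)
  moreover have "inj_on (fp_inr H :: 'b \<Rightarrow> ('a + 'b) list) (carrier H)"
    by (auto simp: inj_on_def fp_inr_def)
  then have "infinite hub"
    using cH unfolding hub_def countable_group_def by (auto simp: finite_Plus_iff dest: finite_imageD)
  ultimately have "\<exists>\<chi>. acts_on H hub \<chi> \<and> (\<forall>x\<in>hub. \<forall>y\<in>hub. \<exists>h\<in>carrier H. \<chi> h x = y)"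
    using transitive_action_on_countable[OF cH] by metis
  from someI_ex[OF this] show "acts_on H hub regular_on_hub"
      "\<And>x y. x \<in> hub \<Longrightarrow> y \<in> hub \<Longrightarrow> \<exists>h\<in>carrier H. regular_on_hub h x = y"
    by (simp_all add: regular_on_hub_def)
qed

lemma right_act: "acts_on H Z right_act"
  unfolding right_act_def
  by (rule acts_on_replace[OF H right_act0 hub_subset hub_stable regular_on_hub(1)])

text \<open>
  A jointly stable set reaches the hub: from a word by deleting letters, and from a point of
  \<open>X\<close> because \<open>T\<close> meets every stable set. It then contains the whole hub, all words by adding
  letters, and all of \<open>X\<close>, since otherwise the complement would be a stable set avoiding \<open>T\<close>.
\<close>

lemma invariant_sets_full:
  assumes R: "R \<subseteq> Z" "R \<noteq> {}" and sG: "stable G left_act R" and sH: "stable H right_act R"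
  shows "R = Z"
proof -
  have "R \<inter> hub \<noteq> {}"
  proof (cases "\<exists>w. Inr w \<in> R")
    case True
    then obtain w where "Inr w \<in> R" by blast
    then show ?thesis
    proof (induction w)
      case Nil
      have "[] \<in> fp_inr H ` carrier H"
        using monoid.one_closed[OF group.is_monoid[OF H]] by (force simp: fp_inr_def)
      then show ?case using Nil by (auto simp: hub_def)
    next
      case (Cons x w)
      have xw: "x # w \<in> fp_words G H" using Cons.prems R by auto
      then have x: "fp_letter G H x" by (simp add: fp_words_def)
      show ?case
      proof (cases x)
        case (Inl g)
        then have g: "g \<in> carrier G" "inv\<^bsub>G\<^esub> g \<in> carrier G" "inv\<^bsub>G\<^esub> g \<otimes>\<^bsub>G\<^esub> g = \<one>\<^bsub>G\<^esub>" "inv\<^bsub>G\<^esub> g \<noteq> \<one>\<^bsub>G\<^esub>"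
          using x G by (auto simp: group.l_inv group.inv_eq_1_iff)
        then have "left_act (inv\<^bsub>G\<^esub> g) (Inr (x # w)) = Inr w"
          by (simp add: left_act_def fp_inl_mult Inl)
        then show ?thesis using Cons sG g by (metis stable_def)
      next
        case (Inr h)
        then have h: "h \<in> carrier H" "inv\<^bsub>H\<^esub> h \<in> carrier H" "inv\<^bsub>H\<^esub> h \<otimes>\<^bsub>H\<^esub> h = \<one>\<^bsub>H\<^esub>" "inv\<^bsub>H\<^esub> h \<noteq> \<one>\<^bsub>H\<^esub>"
          using x H by (auto simp: group.l_inv group.inv_eq_1_iff)
        show ?thesis
        proof (cases "Inr (x # w) \<in> hub")
          case False
          then have "right_act (inv\<^bsub>H\<^esub> h) (Inr (x # w)) = Inr w"
            using h by (simp add: right_act_def right_act0_def fp_inr_mult Inr)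
          then show ?thesis using Cons sH h by (metis stable_def)
        qed (use Cons in blast)
      qed
    qed
  next
    case False
    define R0 where "R0 = Inl -` R"
    have R0: "R = Inl ` R0"
    proof -
      have "y \<in> Inl ` R0" if "y \<in> R" for y using that False by (cases y) (auto simp: R0_def)
      then show ?thesis by (auto simp: R0_def)
    qed
    show ?thesis
    proof
      assume empty: "R \<inter> hub = {}"
      have "stable G \<phi> R0"
        using sG by (force simp: stable_def R0 left_act_def)
      moreover have "stable H \<psi> R0"
        unfolding stable_def
      proof (intro ballI)
        fix h x assume hx: "h \<in> carrier H" "x \<in> R0"
        then have "Inl x \<notin> hub" using empty R0 by blast
        then have "right_act h (Inl x) = Inl (\<psi> h x)" by (simp add: right_act_def right_act0_def)
        then show "\<psi> h x \<in> R0" using hx sH R0 unfolding stable_def R0_def by (metis vimageE vimageI2)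
      qed
      ultimately have "R0 \<inter> T \<noteq> {}" using T_meets[of R0] R by (auto simp: R0)
      then show False using empty by (auto simp: R0 hub_def)
    qed
  qed
  then have hub: "hub \<subseteq> R"
    using regular_on_hub(2) sH unfolding stable_def right_act_def by (smt (verit, best) disjoint_iff subsetI)
  have words: "Inr w \<in> R" if "w \<in> fp_words G H" for w
    using that
  proof (induction w)
    case Nil
    have "[] \<in> fp_inr H ` carrier H"
      using monoid.one_closed[OF group.is_monoid[OF H]] by (force simp: fp_inr_def)
    then show ?case using hub by (auto simp: hub_def)
  next
    case (Cons x w)
    then have w: "Inr w \<in> R" using fp_words_tl by blast
    have x: "fp_letter G H x" using Cons.prems by (simp add: fp_words_def)
    note red = fp_cons_reduced[OF Cons.prems]
    show ?case
    proof (cases x)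
      case (Inl g)
      then have "left_act g (Inr w) = Inr (x # w)" 
        using x red by (simp add: left_act_def fp_inl_mult)
      then show ?thesis using w sG x Inl by (metis stable_def fp_letter.simps(1))
    next
      case (Inr h)
      show ?thesis
      proof (cases "Inr w \<in> hub")
        case False
        then have "right_act h (Inr w) = Inr (x # w)" 
          using x red Inr by (simp add: right_act_def right_act0_def fp_inr_mult)
        then show ?thesis using w sH x Inr by (metis stable_def fp_letter.simps(2))
      next
        case True
        then obtain k where "w = fp_inr H k" by (auto simp: hub_def)
        then have "w = []" using Cons.prems Inr by (auto simp: fp_inr_def fp_words_def split: if_splits)
        then have "x # w = fp_inr H h" using Inr x by (simp add: fp_inr_def)
        then have "Inr (x # w) \<in> hub" using Inr x by (auto simp: hub_def)
        then show ?thesis using hub by blast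
      qed
    qed
  qed
  have "Inl x \<in> R" if "x \<in> X" for x
  proof (rule ccontr)
    assume x: "Inl x \<notin> R"
    define Q where "Q = {x \<in> X. Inl x \<notin> R}"
    have "stable G \<phi> Q"
      unfolding stable_def
    proof (intro ballI)
      fix g x assume g: "g \<in> carrier G" and x: "x \<in> Q"
      then show "\<phi> g x \<in> Q"
        using stable_iff[OF G left_act sG g, of "Inl x"] acts_on_closed[OF \<phi> g]
        by (auto simp: Q_def left_act_def)
    qed
    moreover have "stable H \<psi> Q"
      unfolding stable_def
    proof (intro ballI)
      fix h x assume h: "h \<in> carrier H" and x: "x \<in> Q"
      then have "Inl x \<notin> hub" using hub by (auto simp: Q_def)
      then show "\<psi> h x \<in> Q"
        using x stable_iff[OF H right_act sH h, of "Inl x"] acts_on_closed[OF \<psi> h]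
        by (auto simp: Q_def right_act_def right_act0_def)
    qed
    ultimately have "Q \<inter> T \<noteq> {}" using T_meets[of Q] x \<open>x \<in> X\<close> by (auto simp: Q_def)
    then show False using hub by (auto simp: Q_def hub_def)
  qed
  with words R(1) show ?thesis by auto
qed

definition mean :: "('x + ('a + 'b) list) set \<Rightarrow> real" where "mean A = m (Inl -` A)"

lemma mean_on: "mean_on Z mean"
proof -
  note mm = invariant_mean_mean_on[OF m\<phi>]
  have "Inl -` Z = X" by auto
  moreover have "Inl -` A \<subseteq> X" if "A \<subseteq> Z" for A using that by auto
  ultimately show ?thesis
    using mm mean_on_Un[OF mm] mean_on_nonneg[OF mm] unfolding mean_on_def mean_def
    by (auto simp: vimage_Un simp flip: vimage_Int)
qed

lemma left_mean: "invariant_mean G Z left_act mean"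
  unfolding invariant_mean_iff
proof (intro conjI mean_on ballI allI impI)
  fix g A assume g: "g \<in> carrier G" and A: "A \<subseteq> Z"
  have "(Inl -` left_act g ` A) = \<phi> g ` (Inl -` A)"
  proof (intro equalityI subsetI)
    fix y assume "y \<in> Inl -` left_act g ` A"
    then obtain a where "a \<in> A" "Inl y = left_act g a" by auto
    then show "y \<in> \<phi> g ` (Inl -` A)" by (cases a) (auto simp: left_act_def)
  qed (force simp: left_act_def)
  moreover have "Inl -` A \<subseteq> X" using A by auto
  ultimately show "mean (left_act g ` A) = mean A"
    using invariant_mean_image[OF m\<phi> g] by (simp add: mean_def)
qed

text \<open>
  Outside the null set \<open>T\<close> the new action of \<open>H\<close> agrees with the old one.
\<close>

lemma right_mean: "invariant_mean H Z right_act mean"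
proof (rule invariant_meanI_le[OF H right_act mean_on])
  fix h A assume h: "h \<in> carrier H" and A: "A \<subseteq> Z"
  let ?A = "Inl -` A"
  note mm = invariant_mean_mean_on[OF m\<psi>]
  have AX: "?A \<subseteq> X" using A by auto
  have "m (?A \<inter> T) \<le> m T" by (rule mean_on_mono[OF mm]) (use T in auto)
  then have "m ?A \<le> m (?A - ?A \<inter> T)"
    using mean_on_Diff[OF mm, of "?A \<inter> T" ?A] AX T by simp
  also have "\<dots> = m (\<psi> h ` (?A - ?A \<inter> T))"
    using AX by (intro invariant_mean_image[OF m\<psi> h, symmetric]) auto
  also have "\<dots> \<le> m (Inl -` right_act h ` A)"
  proof (rule mean_on_mono[OF mm])
    have "Inl (\<psi> h x) = right_act h (Inl x)" if "x \<notin> T" for x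
      using that by (auto simp: right_act_def right_act0_def hub_def)
    then show "\<psi> h ` (?A - ?A \<inter> T) \<subseteq> Inl -` right_act h ` A" by auto
    show "Inl -` right_act h ` A \<subseteq> X" using acts_on_image[OF right_act h A] by auto
  qed
  finally show "mean A \<le> mean (right_act h ` A)" by (simp add: mean_def)
qed

text \<open>
  For faithfulness, a nonempty reduced word \<open>w\<close> is applied to a word \<open>z\<close> of two letters for which
  \<open>w @ z\<close> is again reduced. All the intermediate words have at least two letters, so none of them
  lies in the hub, and \<open>w\<close> acts on \<open>z\<close> by multiplication.
\<close>

lemma in_class_A: "in_class_A (free_product G H)"
proof -
  let ?P = "free_product G H"
  interpret P: group ?P by (rule group_free_product[OF G H])
  obtain \<Phi> where \<Phi>: "group_action ?P Z \<Phi>"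
      and \<Phi>l: "\<And>g x. g \<in> carrier G \<Longrightarrow> x \<in> Z \<Longrightarrow> \<Phi> (fp_inl G g) x = left_act g x"
      and \<Phi>r: "\<And>h x. h \<in> carrier H \<Longrightarrow> x \<in> Z \<Longrightarrow> \<Phi> (fp_inr H h) x = right_act h x"
    using free_product_action[OF G H left_act right_act] by metis
  note acts = group_action_imp_acts_on[OF \<Phi>]
  have "invariant_mean ?P Z \<Phi> mean"
  proof (rule invariant_mean_free_product[OF G H \<Phi>])
    have "\<Phi> (fp_inl G g) ` A = left_act g ` A" if "g \<in> carrier G" "A \<subseteq> Z" for g A
      using that \<Phi>l by (intro image_cong) auto
    then show "invariant_mean G Z (\<lambda>g. \<Phi> (fp_inl G g)) mean"
      using left_mean by (simp add: invariant_mean_iff)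
    have "\<Phi> (fp_inr H h) ` A = right_act h ` A" if "h \<in> carrier H" "A \<subseteq> Z" for h A
      using that \<Phi>r by (intro image_cong) auto
    then show "invariant_mean H Z (\<lambda>h. \<Phi> (fp_inr H h)) mean"
      using right_mean by (simp add: invariant_mean_iff)
  qed
  then have amenable: "amenable_action ?P Z \<Phi>" using \<Phi> by (auto simp: amenable_action_def)
  have "\<exists>w\<in>carrier ?P. \<Phi> w x = y" if xy: "x \<in> Z" "y \<in> Z" for x y
  proof -
    let ?O = "orbit_of ?P \<Phi> x"
    have O: "?O \<subseteq> Z" by (rule orbit_of_subset[OF acts xy(1)])
    have st: "stable ?P \<Phi> ?O" by (rule stable_orbit_of[OF P.group_axioms acts xy(1)])
    have "?O = Z"
    proof (rule invariant_sets_full[OF O])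
      show "?O \<noteq> {}" using orbit_of_refl[OF P.group_axioms acts xy(1)] by blast
      have cl: "\<Phi> w y \<in> ?O" if "w \<in> carrier ?P" "y \<in> ?O" for w y
        using st that by (simp add: stable_def)
      show "stable G left_act ?O"
        unfolding stable_def
      proof (intro ballI)
        fix g y assume g: "g \<in> carrier G" and y: "y \<in> ?O"
        have "\<Phi> (fp_inl G g) y \<in> ?O" by (rule cl[OF fp_inl_closed[OF g] y])
        moreover have "y \<in> Z" using O y by blast
        ultimately show "left_act g y \<in> ?O" using \<Phi>l[OF g] by simp
      qed
      show "stable H right_act ?O"
        unfolding stable_def
      proof (intro ballI)
        fix h y assume h: "h \<in> carrier H" and y: "y \<in> ?O"
        have "\<Phi> (fp_inr H h) y \<in> ?O" by (rule cl[OF fp_inr_closed[OF h] y])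
        moreover have "y \<in> Z" using O y by blast
        ultimately show "right_act h y \<in> ?O" using \<Phi>r[OF h] by simp
      qed
    qed
    then have "y \<in> ?O" using xy(2) by simp
    then show ?thesis unfolding orbit_of_def by blast
  qed
  then have transitive: "transitive_action ?P Z \<Phi>"
    using \<Phi> by (simp add: transitive_action_def transitive_action_axioms_def)
  have free: "\<Phi> w (Inr z) = Inr (w @ z)" if "w @ z \<in> fp_words G H" "2 \<le> length z" for w z
    using that(1)
  proof (induction w)
    case Nil
    then show ?case using acts_on_one[OF acts, of "Inr z"] by (auto simp: free_product_def)
  next
    case (Cons x w)
    have wz: "w @ z \<in> fp_words G H" using Cons.prems fp_words_tl[of x] by simp
    then have z: "Inr z \<in> Z" and w: "w \<in> carrier ?P"
      by (auto simp: fp_words_def free_product_def dest: distinct_adj_appendD1 distinct_adj_appendD2)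
    have xw: "x # w \<in> fp_words G H"
      using Cons.prems by (auto simp: fp_words_def dest: distinct_adj_appendD1[of "_ # _", simplified])
    have x: "fp_letter G H x" using xw by (simp add: fp_words_def)
    note red = fp_cons_reduced[OF Cons.prems[simplified]] fp_cons_reduced[OF xw]
    show ?case
    proof (cases x)
      case (Inl g)
      then have "\<Phi> (x # w) (Inr z) = \<Phi> (fp_inl G g) (\<Phi> w (Inr z))"
        using acts_on_mult[OF acts fp_inl_closed w z, of g] red x by (simp add: fp_inl_mult)
      then show ?thesis
        using Cons.IH[OF wz] \<Phi>l[OF _ InrI[OF wz], of g] x Inl red by (simp add: left_act_def fp_inl_mult)
    next
      case (Inr h)
      then have "\<Phi> (x # w) (Inr z) = \<Phi> (fp_inr H h) (\<Phi> w (Inr z))"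
        using acts_on_mult[OF acts fp_inr_closed w z, of h] red x by (simp add: fp_inr_mult)
      moreover have "Inr (w @ z) \<notin> hub"
      proof
        assume "Inr (w @ z) \<in> hub"
        then obtain k where k: "w @ z = fp_inr H k" by (auto simp: hub_def)
        have "length (w @ z) \<le> 1" unfolding k by (simp add: fp_inr_def)
        then show False using that(2) by simp
      qed
      ultimately show ?thesis
        using Cons.IH[OF wz] \<Phi>r[OF _ InrI[OF wz], of h] x Inr red
        by (simp add: right_act_def right_act0_def fp_inr_mult)
    qed
  qed
  have trivial: "w = \<one>\<^bsub>?P\<^esub>" if w: "w \<in> carrier ?P" and id: "\<And>x. x \<in> Z \<Longrightarrow> \<Phi> w x = x" for w
  proof (rule ccontr)
    assume "w \<noteq> \<one>\<^bsub>?P\<^esub>"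
    then have ne: "w \<noteq> []" by (simp add: free_product_def)
    have "\<exists>g\<in>carrier G. g \<noteq> \<one>\<^bsub>G\<^esub>" "\<exists>h\<in>carrier H. h \<noteq> \<one>\<^bsub>H\<^esub>"
      using cG cH infinite_imp_nonempty[of "carrier G - {\<one>\<^bsub>G\<^esub>}"]
        infinite_imp_nonempty[of "carrier H - {\<one>\<^bsub>H\<^esub>}"] by (auto simp: countable_group_def)
    then obtain g h where gh: "fp_letter G H (Inl g)" "fp_letter G H (Inr h)" by auto
    define z where "z = (if isl (last w) then [Inr h, Inl g] else [Inl g, Inr h])"
    have "w @ z \<in> fp_words G H"
      using w gh ne by (auto simp: z_def free_product_def fp_words_def distinct_adj_append_iff last_map)
    moreover from this have "Inr z \<in> Z"
      using gh by (auto simp: fp_words_def z_def)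
    ultimately show False using free[of w z] id[of "Inr z"] ne by (auto simp: z_def)
  qed
  have "inj_on \<Phi> (carrier ?P)"
  proof (rule inj_onI)
    fix u v assume uv: "u \<in> carrier ?P" "v \<in> carrier ?P" and eq: "\<Phi> u = \<Phi> v"
    have "\<Phi> (inv\<^bsub>?P\<^esub> v \<otimes>\<^bsub>?P\<^esub> u) x = x" if "x \<in> Z" for x
      using acts_on_mult[OF acts P.inv_closed[OF uv(2)] uv(1) that] acts_on_cancel(1)[OF P.group_axioms acts uv(2) that] eq
      by simp
    then have "inv\<^bsub>?P\<^esub> v \<otimes>\<^bsub>?P\<^esub> u = \<one>\<^bsub>?P\<^esub>" using uv by (intro trivial) auto
    then show "u = v" using uv by (metis P.inv_equality P.inv_inv P.inv_closed)
  qed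
  then have "faithful_action ?P Z \<Phi>"
    using \<Phi> by (simp add: faithful_action_def faithful_action_axioms_def)
  then show ?thesis
    using transitive amenable by (rule in_class_A_I[OF countable_group_free_product[OF cG cH]])
qed

end

text \<open>
  Let \<open>H\<close> act trivially on the set that \<open>G\<close> acts on.
\<close>

lemma has_null_sweep_imp_class_A:
  assumes G: "countable_group G" and H: "countable_group H" and sweep: "has_null_sweep G"
  shows "in_class_A (free_product G H)"
proof -
  obtain X :: "(nat \<times> nat) set" and \<phi> m T where X: "acts_on G X \<phi>" "invariant_mean G X \<phi> m"
      "T \<subseteq> X" "m T = 0" "\<And>R. R \<subseteq> X \<Longrightarrow> R \<noteq> {} \<Longrightarrow> stable G \<phi> R \<Longrightarrow> R \<inter> T \<noteq> {}"
    using sweep unfolding has_null_sweep_def by metis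
  have "null_attachment G H X T \<phi> (\<lambda>h x. x) m"
    using X G H by unfold_locales (auto simp: acts_on_def invariant_mean_iff)
  then show ?thesis by (rule null_attachment.in_class_A)
qed

section \<open>A line of finite orbits\<close>

text \<open>
  The mean is a limit of the densities on the intervals \<open>{..n}\<close>. An injection that moves no point
  up by more than \<open>c\<close> carries at most \<open>c\<close> points of a set out of \<open>{..n}\<close>, so in the limit it cannot
  decrease densities.
\<close>

lemma density_mean:
  obtains m :: "nat set \<Rightarrow> real" where "mean_on UNIV m" "m {0} = 0"
    "\<And>p A c. inj p \<Longrightarrow> (\<And>x. p x \<le> x + c) \<Longrightarrow> m A \<le> m (p ` A)"
proof -
  define f where "f n A = card (A \<inter> {..n}) / real (Suc n)" for n and A :: "nat set"
  have "0 \<le> f n A \<and> f n A \<le> 1" for n A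
    using card_mono[of "{..n}" "A \<inter> {..n}"] by (simp add: f_def)
  then obtain F m where F: "F \<noteq> bot" "F \<le> sequentially" and lim: "\<And>A. ((\<lambda>n. f n A) \<longlongrightarrow> m A) F"
    using tendsto_along_finer_filter[of f] by metis
  have meq: "m A = b" if "((\<lambda>n. f n A) \<longlongrightarrow> b) F" for A b
    using tendsto_unique[OF F(1) lim that] .
  show ?thesis
  proof
    show "mean_on UNIV m"
      unfolding mean_on_def
    proof (intro conjI allI impI)
      fix A show "0 \<le> m A"
        using lim by (rule tendsto_lowerbound) (use F(1) in \<open>auto simp: f_def\<close>)
    next
      fix A B :: "nat set" assume "A \<inter> B = {}"
      then have "card ((A \<union> B) \<inter> {..n}) = card (A \<inter> {..n}) + card (B \<inter> {..n})" for n
        by (subst card_Un_disjoint[symmetric]) (auto simp: Int_Un_distrib2)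
      then have "f n (A \<union> B) = f n A + f n B" for n
        by (simp add: f_def add_divide_distrib)
      then show "m (A \<union> B) = m A + m B"
        by (intro meq) (simp add: tendsto_add lim)
    next
      have "f n UNIV = 1" for n by (simp add: f_def)
      then show "m UNIV = 1" by (intro meq) simp
    qed
  next
    have "f n {0} = inverse (real (Suc n))" for n by (simp add: f_def inverse_eq_divide)
    then show "m {0} = 0"
      using tendsto_mono[OF F(2) LIMSEQ_inverse_real_of_nat] by (intro meq) simp
  next
    fix p :: "nat \<Rightarrow> nat" and A c assume p: "inj p" "\<And>x. p x \<le> x + c"
    have "f n A \<le> f n (p ` A) + c * inverse (real (Suc n))" for n
    proof -
      have "p ` (A \<inter> {..n}) \<subseteq> (p ` A \<inter> {..n}) \<union> {n<..n + c}"
        using p(2) by (fastforce intro: order_trans)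
      then have "card (p ` (A \<inter> {..n})) \<le> card ((p ` A \<inter> {..n}) \<union> {n<..n + c})"
        by (intro card_mono) auto
      also have "\<dots> \<le> card (p ` A \<inter> {..n}) + c"
        using card_Un_le[of "p ` A \<inter> {..n}" "{n<..n + c}"] by simp
      finally have "card (A \<inter> {..n}) \<le> card (p ` A \<inter> {..n}) + c"
        using card_image[OF inj_on_subset[OF p(1)], of "A \<inter> {..n}"] by simp
      then show ?thesis by (simp add: f_def divide_simps)
    qed
    moreover have "((\<lambda>n. f n (p ` A) + c * inverse (real (Suc n))) \<longlongrightarrow> m (p ` A) + real c * 0) F"
      by (intro tendsto_add tendsto_mult tendsto_const lim tendsto_mono[OF F(2) LIMSEQ_inverse_real_of_nat])
    ultimately show "m A \<le> m (p ` A)"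
      using tendsto_le[OF F(1) _ lim, of _ "m (p ` A)" A] by simp
  qed
qed

text \<open>
  For \<open>k \<le> c\<close> the intervals of length \<open>k\<close> that start at \<open>a\<close>, \<open>a + c\<close>, \<open>a + 2 c\<close>, and so on each carry a copy of
  the action \<open>\<phi>\<close> on \<open>{..<k}\<close>; all other points are fixed.
\<close>

definition block_act :: "nat \<Rightarrow> nat \<Rightarrow> nat \<Rightarrow> ('a \<Rightarrow> nat \<Rightarrow> nat) \<Rightarrow> 'a \<Rightarrow> nat \<Rightarrow> nat" where
  "block_act a c k \<phi> g x =
     (if a \<le> x \<and> (x - a) mod c < k then a + (x - a) div c * c + \<phi> g ((x - a) mod c) else x)"

lemma block_act_block:
  assumes "k \<le> c" "r < k"
  shows "block_act a c k \<phi> g (a + q * c + r) = a + q * c + \<phi> g r"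
proof -
  have "a + q * c + r - a = r + q * c" by simp
  then have "(a + q * c + r - a) mod c = r" "(a + q * c + r - a) div c = q"
    using assms by (simp_all only: mod_mult_self1 div_mult_self1) simp_all
  then show ?thesis using assms by (simp add: block_act_def)
qed

lemma block_cases:
  fixes x a c k :: nat
  obtains q r where "r < k" "x = a + q * c + r" 
  | "\<not> (a \<le> x \<and> (x - a) mod c < k)"
proof (cases "a \<le> x \<and> (x - a) mod c < k")
  case True
  then have "x = a + (x - a) div c * c + (x - a) mod c"
    using div_mult_mod_eq[of "x - a" c] by linarith
  then show ?thesis using that(1) True by blast
qed (use that in blast)

lemma acts_on_block_act:
  assumes \<phi>: "acts_on G {..<k} \<phi>" and kc: "k \<le> c"
  shows "acts_on G UNIV (block_act a c k \<phi>)"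
proof (rule acts_onI)
  fix x show "block_act a c k \<phi> \<one>\<^bsub>G\<^esub> x = x"
    by (cases rule: block_cases[of k x a c]) (use acts_on_one[OF \<phi>] in \<open>auto simp: block_act_block[OF kc], auto simp: block_act_def\<close>)
next
  fix g h x assume gh: "g \<in> carrier G" "h \<in> carrier G"
  show "block_act a c k \<phi> (g \<otimes>\<^bsub>G\<^esub> h) x = block_act a c k \<phi> g (block_act a c k \<phi> h x)"
  proof (cases rule: block_cases[of k x a c])
    case (1 q r)
    then have "\<phi> h r < k" using acts_on_closed[OF \<phi> gh(2)] by simp
    then show ?thesis using 1 gh acts_on_mult[OF \<phi>] by (simp add: block_act_block[OF kc])
  next
    case 2
    then have "block_act a c k \<phi> g x = x" for g unfolding block_act_def by (rule if_not_P)
    then show ?thesis by simp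
  qed
qed simp

lemma block_act_le:
  assumes \<phi>: "acts_on G {..<k} \<phi>" and kc: "k \<le> c" and g: "g \<in> carrier G"
  shows "block_act a c k \<phi> g x \<le> x + c"
proof (cases rule: block_cases[of k x a c])
  case (1 q r)
  then have "\<phi> g r < k" using acts_on_closed[OF \<phi> g] by simp
  then show ?thesis using 1 kc by (simp add: block_act_block[OF kc])
next
  case 2
  then have "block_act a c k \<phi> g x = x" unfolding block_act_def by (rule if_not_P)
  then show ?thesis by simp
qed

lemma block_act_decreases:
  assumes tr: "\<forall>x<k. \<forall>y<k. \<exists>g\<in>carrier G. \<phi> g x = y" and kc: "k \<le> c" and r: "0 < r" "r < k"
  shows "\<exists>g\<in>carrier G. block_act a c k \<phi> g (a + q * c + r) < a + q * c + r"
proof -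
  obtain g where "g \<in> carrier G" "\<phi> g r = 0" using tr r by (meson gr_zeroI less_trans)
  then show ?thesis using r by (intro bexI[of _ g]) (simp_all add: block_act_block[OF kc])
qed

text \<open>
  Cover the natural numbers by intervals of \<open>k\<close> and of \<open>l\<close> points in alternation, consecutive ones
  sharing one endpoint, so that the pattern repeats after \<open>(k - 1) + (l - 1)\<close> points. Let \<open>G\<close> act
  transitively on the intervals of the first kind and \<open>H\<close> on those of the second kind. All
  displacements are bounded, so density is invariant, and the point 0 alone is a null set that
  meets every jointly stable set. It is fixed by \<open>H\<close>, as the first interval of \<open>H\<close> starts at
  \<open>k - 1\<close>.
\<close>

lemma transitive_of_degree_imp_class_A:
  assumes G: "countable_group G" and H: "countable_group H"
    and k: "transitive_of_degree G k" "2 \<le> k" and l: "transitive_of_degree H l" "2 \<le> l"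
  shows "in_class_A (free_product G H)"
proof -
  have gG: "group G" and gH: "group H" using G H by (simp_all add: countable_group_def)
  obtain \<phi> where \<phi>: "acts_on G {..<k} \<phi>" "\<forall>x<k. \<forall>y<k. \<exists>g\<in>carrier G. \<phi> g x = y"
    using k by (auto simp: transitive_of_degree_def)
  obtain \<psi> where \<psi>: "acts_on H {..<l} \<psi>" "\<forall>x<l. \<forall>y<l. \<exists>g\<in>carrier H. \<psi> g x = y"
    using l by (auto simp: transitive_of_degree_def)
  define c where "c = k + l - 2"
  have kc: "k \<le> c" and lc: "l \<le> c" using k l by (auto simp: c_def)
  define \<alpha> where "\<alpha> = block_act 0 c k \<phi>"
  define \<beta> where "\<beta> = block_act (k - 1) c l \<psi>"
  have \<alpha>: "acts_on G UNIV \<alpha>" unfolding \<alpha>_def by (rule acts_on_block_act[OF \<phi>(1) kc])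
  have \<beta>: "acts_on H UNIV \<beta>" unfolding \<beta>_def by (rule acts_on_block_act[OF \<psi>(1) lc])
  obtain m :: "nat set \<Rightarrow> real" where m: "mean_on UNIV m" "m {0} = 0"
    "\<And>p A c. inj p \<Longrightarrow> (\<And>x. p x \<le> x + c) \<Longrightarrow> m A \<le> m (p ` A)"
    by (rule density_mean) blast
  have "null_attachment G H UNIV {0} \<alpha> \<beta> m"
  proof
    show "invariant_mean G UNIV \<alpha> m"
    proof (rule invariant_meanI_le[OF gG \<alpha> m(1)])
      fix g A assume g: "g \<in> carrier G"
      show "m A \<le> m (\<alpha> g ` A)"
        using m(3)[OF acts_on_inj[OF gG \<alpha> g], of c A] block_act_le[OF \<phi>(1) kc g] by (simp add: \<alpha>_def)
    qed
    show "invariant_mean H UNIV \<beta> m"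
    proof (rule invariant_meanI_le[OF gH \<beta> m(1)])
      fix g A assume g: "g \<in> carrier H"
      show "m A \<le> m (\<beta> g ` A)"
        using m(3)[OF acts_on_inj[OF gH \<beta> g], of c A] block_act_le[OF \<psi>(1) lc g] by (simp add: \<beta>_def)
    qed
    fix h and t :: nat assume "t \<in> {0}"
    then show "\<beta> h t = t" using k by (simp add: \<beta>_def block_act_def)
  next
    fix R :: "nat set" assume R: "R \<noteq> {}" and sG: "stable G \<alpha> R" and sH: "stable H \<beta> R"
    define x where "x = (LEAST x. x \<in> R)"
    have x: "x \<in> R" and least: "\<And>y. y \<in> R \<Longrightarrow> x \<le> y"
      using R unfolding x_def by (auto intro: LeastI Least_le)
    have "x = 0"
    proof (rule ccontr)
      assume "x \<noteq> 0"
      have noG: False if xr: "x = q * c + r" "0 < r" "r < k" for q r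
      proof -
        obtain g where "g \<in> carrier G" "\<alpha> g x < x"
          using block_act_decreases[OF \<phi>(2) kc xr(2,3), of 0 q] xr(1) by (auto simp: \<alpha>_def)
        then show False using least[of "\<alpha> g x"] sG x by (simp add: stable_def)
      qed
      have noH: False if xr: "x = k - 1 + q * c + r" "0 < r" "r < l" for q r
      proof -
        obtain g where "g \<in> carrier H" "\<beta> g x < x"
          using block_act_decreases[OF \<psi>(2) lc xr(2,3), of "k - 1" q] xr(1) by (auto simp: \<beta>_def)
        then show False using least[of "\<beta> g x"] sH x by (simp add: stable_def)
      qed
      define q where "q = x div c"
      define r where "r = x mod c"
      have x_eq: "x = q * c + r" and rc: "r < c" using kc k by (simp_all add: q_def r_def)
      consider "0 < r \<and> r < k" | "r = 0" | "k \<le> r" by linarith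
      then show False
      proof cases
        case 1
        then show False using noG[OF x_eq] by simp
      next
        case 2
        then obtain q' where "q = Suc q'" using x_eq \<open>x \<noteq> 0\<close> by (cases q) auto
        then have "x = k - 1 + q' * c + (l - 1)" using 2 x_eq k l by (simp add: c_def)
        then show False using noH[of q' "l - 1"] l by simp
      next
        case 3
        then have "x = k - 1 + q * c + (r - (k - 1))" using x_eq k by simp
        moreover have "0 < r - (k - 1)" "r - (k - 1) < l"
          using 3 rc k(2) l(2) unfolding c_def by linarith+
        ultimately show False by (rule noH)
      qed
    qed
    then show "R \<inter> {0} \<noteq> {}" using x by blast
  qed (use G H \<alpha> \<beta> m in auto)
  then show ?thesis by (rule null_attachment.in_class_A)
qed

section \<open>Consequences of the fixed point property\<close>

text \<open>
  If the set \<open>N\<close> of the points that are not fixed had positive mean, then the normalised mean on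
  one copy of \<open>N\<close> would make \<open>G\<close> act amenably and without fixed points on countably many copies of
  \<open>N\<close>. The copies make the set infinite even if \<open>N\<close> is finite.
\<close>

lemma property_F_mean_fixed:
  fixes G :: "('a, 'm) monoid_scheme" and X :: "'x set"
  assumes G: "group G" and F: "property_F G" and X: "countable X"
    and act: "acts_on G X \<phi>" and m: "invariant_mean G X \<phi> m"
  shows "m {x \<in> X. \<forall>g\<in>carrier G. \<phi> g x = x} = 1"
proof (rule ccontr)
  let ?Fix = "{x \<in> X. \<forall>g\<in>carrier G. \<phi> g x = x}"
  assume "m ?Fix \<noteq> 1"
  note mm = invariant_mean_mean_on[OF m]
  define N where "N = X - ?Fix"
  have NX: "N \<subseteq> X" by (auto simp: N_def)
  have "m N = 1 - m ?Fix" unfolding N_def using mean_on_Diff[OF mm] mm by (simp add: mean_on_def)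
  moreover have "m ?Fix \<le> 1" by (rule mean_on_le_1[OF mm]) auto
  ultimately have mN: "m N > 0" using \<open>m ?Fix \<noteq> 1\<close> by simp
  have "stable G \<phi> ?Fix" by (auto simp: stable_def)
  then have N: "\<phi> g x \<in> N" if "g \<in> carrier G" "x \<in> N" for g x
    using that stable_iff[OF G act _ that(1), of ?Fix x] acts_on_closed[OF act that(1), of x]
    by (simp add: N_def del: mem_Collect_eq)
  define \<psi> :: "'a \<Rightarrow> nat \<times> 'x \<Rightarrow> nat \<times> 'x" where "\<psi> g = map_prod id (\<phi> g)" for g
  define Y where "Y = (UNIV :: nat set) \<times> N"
  define \<mu> where "\<mu> A = m (N \<inter> Pair 0 -` A) / m N" for A :: "(nat \<times> 'x) set"
  have \<psi>: "acts_on G Y \<psi>"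
    using act N NX by (intro acts_onI) (auto simp: Y_def \<psi>_def acts_on_def)
  have "invariant_mean G Y \<psi> \<mu>"
    unfolding invariant_mean_iff mean_on_def
  proof (intro conjI allI impI ballI)
    fix A show "0 \<le> \<mu> A" using mN NX mean_on_nonneg[OF mm, of "N \<inter> Pair 0 -` A"] by (simp add: \<mu>_def le_infI1)
  next
    fix A B :: "(nat \<times> 'x) set" assume "A \<inter> B = {}"
    then have "m (N \<inter> Pair 0 -` (A \<union> B)) = m (N \<inter> Pair 0 -` A) + m (N \<inter> Pair 0 -` B)"
      using NX by (subst mean_on_Un[OF mm, symmetric]) (auto intro!: arg_cong[where f = m])
    then show "\<mu> (A \<union> B) = \<mu> A + \<mu> B" by (simp add: \<mu>_def add_divide_distrib)
  next
    show "\<mu> Y = 1" using mN by (simp add: \<mu>_def Y_def vimage_def)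
  next
    fix g A assume g: "g \<in> carrier G" and A: "A \<subseteq> Y"
    have "N \<inter> Pair 0 -` \<psi> g ` A = \<phi> g ` (N \<inter> Pair 0 -` A)"
      using A N[OF g] by (force simp: \<psi>_def Y_def)
    then show "\<mu> (\<psi> g ` A) = \<mu> A"
      using invariant_mean_image[OF m g, of "N \<inter> Pair 0 -` A"] NX by (simp add: \<mu>_def le_infI1)
  qed
  then have am: "amenable_action G Y (\<lambda>g. restrict (\<psi> g) Y)" by (rule amenable_actionI[OF G \<psi>])
  have "N \<noteq> {}" using mN mean_on_empty[OF mm] by auto
  then have "infinite Y" by (simp add: Y_def finite_cartesian_product_iff)
  moreover have "countable Y" using X NX countable_subset by (auto simp: Y_def)
  ultimately obtain y where y: "y \<in> Y" "\<forall>g\<in>carrier G. restrict (\<psi> g) Y y = y"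
    using property_F_D[OF F _ _ am] by blast
  then have "\<phi> g (snd y) = snd y" if "g \<in> carrier G" for g
    using that by (cases y) (auto simp: \<psi>_def)
  moreover have "snd y \<in> N" using y by (auto simp: Y_def)
  ultimately show False by (auto simp: N_def)
qed

text \<open>
  Let \<open>K\<close> be a subgroup of finite index in \<open>H\<close> with property (F). The fixed points of \<open>G\<close> have
  mean 1, so have their translates by \<open>H\<close>, and so have the fixed points of \<open>K\<close>. As finitely many
  translates, one for each coset of \<open>K\<close>, are involved, there is a point fixed by \<open>K\<close> whose whole
  \<open>H\<close>-orbit is fixed by \<open>G\<close>. This orbit is invariant under the free product, hence it is the whole
  set and \<open>G\<close> acts trivially.
\<close>

lemma property_F_virtually_F_not_class_A:
  fixes G :: "('a, 'm) monoid_scheme" and H :: "('b, 'n) monoid_scheme"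
  assumes cG: "countable_group G" and cH: "countable_group H"
    and FG: "property_F G" and vF: "virtually_F H"
  shows "\<not> in_class_A (free_product G H)"
proof
  let ?P = "free_product G H"
  assume "in_class_A ?P"
  then obtain S :: "nat set" and \<Phi> m where S: "faithful_action ?P S \<Phi>" "transitive_action ?P S \<Phi>"
      "group_action ?P S \<Phi>" "invariant_mean ?P S \<Phi> m"
    by (auto simp: in_class_A_def amenable_action_def)
  interpret G: group G using cG by (simp add: countable_group_def)
  interpret H: group H using cH by (simp add: countable_group_def)
  interpret P: group ?P by (rule group_free_product[OF G.group_axioms H.group_axioms])
  note acts = group_action_imp_acts_on[OF S(3)]
  note mm = invariant_mean_mean_on[OF S(4)]
  define \<phi> where "\<phi> g = \<Phi> (fp_inl G g)" for g
  define \<psi> where "\<psi> h = \<Phi> (fp_inr H h)" for h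
  have hom: "fp_inl G \<in> hom G ?P" "fp_inr H \<in> hom H ?P"
    by (rule fp_inl_hom fp_inr_hom, rule G.group_axioms, rule H.group_axioms)+
  have \<phi>: "acts_on G S \<phi>"
    using acts_on_closed[OF acts] acts_on_one[OF acts] acts_on_mult[OF acts] fp_inl_closed[of _ G H]
      hom_mult[OF hom(1)] hom_one[OF hom(1)]
    by (intro acts_onI) (simp_all add: \<phi>_def G.group_axioms P.group_axioms)
  have \<psi>: "acts_on H S \<psi>"
    using acts_on_closed[OF acts] acts_on_one[OF acts] acts_on_mult[OF acts] fp_inr_closed[of _ H G]
      hom_mult[OF hom(2)] hom_one[OF hom(2)]
    by (intro acts_onI) (simp_all add: \<psi>_def H.group_axioms P.group_axioms)
  have m\<phi>: "invariant_mean G S \<phi> m" and m\<psi>: "invariant_mean H S \<psi> m"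
    using S(4) fp_inl_closed[of _ G H] fp_inr_closed[of _ H G] by (auto simp: invariant_mean_iff \<phi>_def \<psi>_def)
  obtain K where K: "subgroup K H" "finite (rcosets\<^bsub>H\<^esub> K)" "property_F (H\<lparr>carrier := K\<rparr>)"
    using vF by (auto simp: virtually_F_def)
  have KH: "K \<subseteq> carrier H" by (rule subgroup.subset[OF K(1)])
  define A where "A = {x \<in> S. \<forall>g\<in>carrier G. \<phi> g x = x}"
  define B where "B = {x \<in> S. \<forall>k\<in>K. \<psi> k x = x}"
  have mA: "m A = 1"
    unfolding A_def using property_F_mean_fixed[OF G.group_axioms FG _ \<phi> m\<phi>] by simp
  have \<psi>K: "acts_on (H\<lparr>carrier := K\<rparr>) S \<psi>" "invariant_mean (H\<lparr>carrier := K\<rparr>) S \<psi> m"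
    using \<psi> m\<psi> by (auto simp: acts_on_def invariant_mean_iff subsetD[OF KH])
  have mB: "m B = 1"
    unfolding B_def using property_F_mean_fixed[OF H.subgroup_imp_group[OF K(1)] K(3) _ \<psi>K] by simp
  define r where "r Q = (SOME h. h \<in> carrier H \<and> Q = K #>\<^bsub>H\<^esub> h)" for Q
  have r: "r Q \<in> carrier H \<and> Q = K #>\<^bsub>H\<^esub> r Q" if Q: "Q \<in> rcosets\<^bsub>H\<^esub> K" for Q
  proof -
    have "\<exists>h. h \<in> carrier H \<and> Q = K #>\<^bsub>H\<^esub> h" using Q by (auto simp: RCOSETS_def)
    then show ?thesis unfolding r_def by (rule someI_ex)
  qed
  define D where "D = r ` (rcosets\<^bsub>H\<^esub> K)"
  have D: "finite D" "D \<subseteq> carrier H" using K(2) r by (auto simp: D_def)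
  have "m (B \<inter> (S \<inter> (\<Inter>d\<in>D. \<psi> d ` A))) = 1"
  proof (rule mean_on_Int_1[OF mm _ mB])
    show "m (S \<inter> (\<Inter>d\<in>D. \<psi> d ` A)) = 1"
    proof (rule mean_on_INT_1[OF mm D(1)])
      fix d assume "d \<in> D"
      then have "d \<in> carrier H" using D by blast
      then show "\<psi> d ` A \<subseteq> S \<and> m (\<psi> d ` A) = 1"
        using invariant_mean_image[OF m\<psi>, of d A] acts_on_image[OF \<psi>, of d A] mA by (auto simp: A_def)
    qed
  qed (auto simp: B_def)
  then have "B \<inter> (S \<inter> (\<Inter>d\<in>D. \<psi> d ` A)) \<noteq> {}"
    using mean_on_empty[OF mm] by (metis zero_neq_one)
  then obtain x where x: "x \<in> B" "x \<in> S" "\<And>d. d \<in> D \<Longrightarrow> x \<in> \<psi> d ` A"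
    by blast
  let ?O = "orbit_of H \<psi> x"
  have OA: "?O \<subseteq> A"
  proof
    fix y assume "y \<in> ?O"
    then obtain h where h: "h \<in> carrier H" "y = \<psi> h x" by (auto simp: orbit_of_def)
    \<comment> \<open>Write \<open>h\<inverse> = k d\<close>; then \<open>h x = d\<inverse> k\<inverse> x = d\<inverse> x\<close>.\<close>
    define d where "d = r (K #>\<^bsub>H\<^esub> inv\<^bsub>H\<^esub> h)"
    have Q: "K #>\<^bsub>H\<^esub> inv\<^bsub>H\<^esub> h \<in> rcosets\<^bsub>H\<^esub> K" using h by (auto simp: RCOSETS_def)
    have d: "d \<in> D" "d \<in> carrier H" using Q r by (auto simp: D_def d_def)
    have "inv\<^bsub>H\<^esub> h \<in> K #>\<^bsub>H\<^esub> d"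
      using H.rcos_self[OF _ K(1), of "inv\<^bsub>H\<^esub> h"] h r[OF Q] by (simp add: d_def)
    then obtain k where k: "k \<in> K" "inv\<^bsub>H\<^esub> h = k \<otimes>\<^bsub>H\<^esub> d" by (auto simp: r_coset_def)
    have kH: "k \<in> carrier H" using k KH by blast
    have "h = inv\<^bsub>H\<^esub> d \<otimes>\<^bsub>H\<^esub> inv\<^bsub>H\<^esub> k"
      using k h d kH by (metis H.inv_inv H.inv_mult_group)
    then have "y = \<psi> (inv\<^bsub>H\<^esub> d) (\<psi> (inv\<^bsub>H\<^esub> k) x)"
      using h d kH x acts_on_mult[OF \<psi>] by simp
    moreover have "\<psi> (inv\<^bsub>H\<^esub> k) x = x"
      using x(1) subgroup.m_inv_closed[OF K(1) k(1)] by (simp add: B_def)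
    ultimately have y: "y = \<psi> (inv\<^bsub>H\<^esub> d) x" by simp
    obtain a where a: "a \<in> A" "x = \<psi> d a" using x(3)[OF d(1)] by blast
    then have "y = a" using y acts_on_cancel(1)[OF H.group_axioms \<psi> d(2), of a] by (simp add: A_def)
    then show "y \<in> A" using a by simp
  qed
  have OS: "?O \<subseteq> S" by (rule orbit_of_subset[OF \<psi> x(2)])
  have st: "stable ?P \<Phi> ?O"
  proof (rule stable_free_product[OF S(3) OS])
    show "stable G (\<lambda>g. \<Phi> (fp_inl G g)) ?O"
      using OA by (auto simp: stable_def A_def \<phi>_def)
    show "stable H (\<lambda>h. \<Phi> (fp_inr H h)) ?O"
      using stable_orbit_of[OF H.group_axioms \<psi> x(2)] by (simp add: stable_def \<psi>_def)
  qed
  have "S \<subseteq> ?O"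
  proof
    fix y assume "y \<in> S"
    then obtain w where "w \<in> carrier ?P" "\<Phi> w x = y"
      using transitive_action.unique_orbit[OF S(2) x(2)] by blast
    then show "y \<in> ?O"
      using st orbit_of_refl[OF H.group_axioms \<psi> x(2)] by (auto simp: stable_def)
  qed
  then have triv: "\<phi> g y = y" if "g \<in> carrier G" "y \<in> S" for g y
    using OA that by (auto simp: A_def)
  have "infinite (carrier G - {\<one>\<^bsub>G\<^esub>})" using cG by (simp add: countable_group_def)
  then obtain g where g: "g \<in> carrier G" "g \<noteq> \<one>\<^bsub>G\<^esub>" using infinite_imp_nonempty by blast
  have "\<Phi> (fp_inl G g) = \<Phi> \<one>\<^bsub>?P\<^esub>"
  proof (rule extensionalityI)
    show "\<Phi> (fp_inl G g) \<in> extensional S" "\<Phi> \<one>\<^bsub>?P\<^esub> \<in> extensional S"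
      using group_action.bij_prop0[OF S(3)] fp_inl_closed[OF g(1), of H] P.one_closed
      by (blast dest: Bij_imp_extensional)+
    fix y assume "y \<in> S"
    then show "\<Phi> (fp_inl G g) y = \<Phi> \<one>\<^bsub>?P\<^esub> y"
      using triv[OF g(1)] acts_on_one[OF acts] by (simp add: \<phi>_def)
  qed
  then have "fp_inl G g = \<one>\<^bsub>?P\<^esub>"
    using faithful_action.faithful[OF S(1)] fp_inl_closed[OF g(1), of H] P.one_closed by (meson inj_onD)
  then show False using g by (simp add: fp_inl_def free_product_def)
qed

theorem theorem1p5:
  fixes G :: "('a, 'm) monoid_scheme" and H :: "('b, 'n) monoid_scheme"
  assumes "countable_group G" and "countable_group H"
  shows "in_class_A (free_product G H) \<longleftrightarrow>
    \<not> (property_F G \<and> virtually_F H) \<and> \<not> (property_F H \<and> virtually_F G)"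
proof
  assume A: "in_class_A (free_product G H)"
  then have "\<not> (property_F G \<and> virtually_F H)"
    using property_F_virtually_F_not_class_A[OF assms] by blast
  moreover have "\<not> (property_F H \<and> virtually_F G)"
    using property_F_virtually_F_not_class_A[OF assms(2,1)] in_class_A_swap[OF assms A] by blast
  ultimately show "\<not> (property_F G \<and> virtually_F H) \<and> \<not> (property_F H \<and> virtually_F G)"
    by simp
next
  assume not: "\<not> (property_F G \<and> virtually_F H) \<and> \<not> (property_F H \<and> virtually_F G)"
  have gG: "group G" and gH: "group H" using assms by (simp_all add: countable_group_def)
  have sweep: "virtually_F G \<or> has_null_sweep G" "virtually_F H \<or> has_null_sweep H"
    using has_null_sweepI[OF gG not_virtually_F_imp_orbits_ge[OF gG]]
      has_null_sweepI[OF gH not_virtually_F_imp_orbits_ge[OF gH]] by auto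
  then consider "has_null_sweep G" | "has_null_sweep H" | "\<not> property_F G" "\<not> property_F H"
    using not by blast
  then show "in_class_A (free_product G H)"
  proof cases
    case 1
    then show ?thesis by (rule has_null_sweep_imp_class_A[OF assms])
  next
    case 2
    then have "in_class_A (free_product H G)" by (rule has_null_sweep_imp_class_A[OF assms(2,1)])
    then show ?thesis by (rule in_class_A_swap[OF assms(2,1)])
  next
    case 3
    consider "has_null_sweep G" | "has_null_sweep H"
      | k l where "transitive_of_degree G k" "2 \<le> k" "transitive_of_degree H l" "2 \<le> l"
      using not_F_cases[OF gG 3(1)] not_F_cases[OF gH 3(2)] by blast
    then show ?thesis
    proof cases
      case 1
      then show ?thesis by (rule has_null_sweep_imp_class_A[OF assms])
    next
      case 2
      then have "in_class_A (free_product H G)" by (rule has_null_sweep_imp_class_A[OF assms(2,1)])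
      then show ?thesis by (rule in_class_A_swap[OF assms(2,1)])
    qed (rule transitive_of_degree_imp_class_A[OF assms])
  qed
qed

end
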